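(* Let $G$ be a factor-critical graph with at least $7$ vertices. Then $G$ is an edge-stable equimatchable graph if and only if $G$ is a complete graph on an odd number of vertices, or $G\in\mathcal{G}_1$, or $G\in\mathcal{G}_2$, where: $\mathcal{G}_1$ is the family of graphs isomorphic to $K_{2r+1}\setminus M$ for some integer $r\ge 3$ and some nonempty matching $M$ of $K_{2r+1}$ (i.e. the complete graph on $2r+1$ vertices with the edges of $M$ removed); $\mathcal{G}_2$ is the family of graphs $G$ admitting an independent set $S$ with $|S|\ge 3$ such that every vertex of $S$ is adjacent to every vertex of $V(G)\setminus S$, and such that the maximum matching size of the induced subgraph $G[V(G)\setminus S]$ equals $1$.
   Context: All graphs are finite and simple. A matching is maximal if no other matching properly contains it. A graph $G$ is equimatchable if every maximal matching of $G$ has the same cardinality. An equimatchable graph $G$ is edge-stable (an ESE-graph) if $G\setminus e=(V(G),E(G)\setminus\{e\})$ is equimatchable for every $e\in E(G)$. A graph $G$ is factor-critical if $G-v$ has a perfect matching for every $v\in V(G)$. $\nu(H)$ denotes the maximum size of a matching of $H$. *)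

theory Defs
  imports Main
begin

definition simple_graph :: "'a set \<Rightarrow> 'a set set \<Rightarrow> bool" where
  "simple_graph V E \<longleftrightarrow> finite V \<and> (\<forall>e\<in>E. \<exists>u v. u \<noteq> v \<and> u \<in> V \<and> v \<in> V \<and> e = {u, v})"

definition complete_edges :: "'a set \<Rightarrow> 'a set set" where
  "complete_edges V = {{u, v} | u v. u \<in> V \<and> v \<in> V \<and> u \<noteq> v}"

definition matching :: "'a set set \<Rightarrow> 'a set set \<Rightarrow> bool" where
  "matching E M \<longleftrightarrow> M \<subseteq> E \<and> (\<forall>e1\<in>M. \<forall>e2\<in>M. e1 \<noteq> e2 \<longrightarrow> e1 \<inter> e2 = {})"

definition maximal_matching :: "'a set set \<Rightarrow> 'a set set \<Rightarrow> bool" where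
  "maximal_matching E M \<longleftrightarrow> matching E M \<and> (\<forall>M'. matching E M' \<and> M \<subseteq> M' \<longrightarrow> M' = M)"

definition equimatchable :: "'a set set \<Rightarrow> bool" where
  "equimatchable E \<longleftrightarrow>
     (\<forall>M1 M2. maximal_matching E M1 \<and> maximal_matching E M2 \<longrightarrow> card M1 = card M2)"

definition ESE :: "'a set set \<Rightarrow> bool" where
  "ESE E \<longleftrightarrow> equimatchable E \<and> (\<forall>e\<in>E. equimatchable (E - {e}))"

definition factor_critical :: "'a set \<Rightarrow> 'a set set \<Rightarrow> bool" where
  "factor_critical V E \<longleftrightarrow>
     (\<forall>v\<in>V. \<exists>M. matching {e \<in> E. v \<notin> e} M \<and> \<Union>M = V - {v})"

definition nu :: "'a set set \<Rightarrow> nat" where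
  "nu E = Max (card ` {M. matching E M})"

definition induced_edges :: "'a set set \<Rightarrow> 'a set \<Rightarrow> 'a set set" where
  "induced_edges E U = {e \<in> E. e \<subseteq> U}"

definition graph_iso :: "'a set \<Rightarrow> 'a set set \<Rightarrow> 'b set \<Rightarrow> 'b set set \<Rightarrow> bool" where
  "graph_iso V E W F \<longleftrightarrow> (\<exists>f. bij_betw f V W \<and> (\<forall>u\<in>V. \<forall>v\<in>V. {u, v} \<in> E \<longleftrightarrow> {f u, f v} \<in> F))"

definition in_G1 :: "'a set \<Rightarrow> 'a set set \<Rightarrow> bool" where
  "in_G1 V E \<longleftrightarrow> (\<exists>(r::nat) M. r \<ge> 3 \<and> matching (complete_edges {0..<2*r+1}) M \<and> M \<noteq> {} \<and>
      graph_iso V E {0..<2*r+1} (complete_edges {0..<2*r+1} - M))"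

definition in_G2 :: "'a set \<Rightarrow> 'a set set \<Rightarrow> bool" where
  "in_G2 V E \<longleftrightarrow> (\<exists>S. S \<subseteq> V \<and> card S \<ge> 3 \<and>
      (\<forall>u\<in>S. \<forall>v\<in>S. {u, v} \<notin> E) \<and>
      (\<forall>u\<in>S. \<forall>v\<in>V - S. {u, v} \<in> E) \<and>
      nu (induced_edges E (V - S)) = 1)"

end

theory Submission
  imports Defs
begin

text \<open>
  Write \<open>G\<close> for the graph, with \<open>2 k + 1\<close> vertices. Since \<open>G\<close> is factor-critical, it and each
  \<open>G - e\<close> have a maximal matching missing a single vertex. Hence \<open>G\<close> is edge-stable
  equimatchable iff no matching leaves uncovered a set of at least three vertices that spans at
  most one edge. If every vertex has at most one non-neighbour, any three vertices span two edges,
  which gives the complete graphs and the family \<open>G1\<close>.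

  Otherwise some vertex has two non-neighbours. A largest matching avoiding such a triple
  leaves five vertices, which induce either the join of an independent pair with the triple or
  a 5-cycle. The matching edges are then added back one at a time: a 5-cycle cannot be extended by
  any edge, while a complete join of an independent set \<open>S\<close> with a set of size \<open>|S| + 1\<close> always
  extends to another such join. Uncovering three vertices of \<open>S\<close> shows that the other side has no
  two disjoint edges, and factor-criticality gives it at least one.
\<close>

section \<open>Triples left uncovered by a matching\<close>

locale adjacency =
  fixes A :: "'a \<Rightarrow> 'a \<Rightarrow> bool"
  assumes sym: "A x y \<Longrightarrow> A y x" and irrefl: "\<not> A x x"
begin

text \<open>The vertex set covered by a matching, with the edges themselves forgotten, so that an
  edge can be peeled off or added one at a time. Distinctness of \<open>u\<close> and
  \<open>v\<close> comes from irreflexivity.\<close>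

inductive perfectly_matched :: "'a set \<Rightarrow> bool" where
  empty: "perfectly_matched {}"
| step: "\<lbrakk>perfectly_matched X; A u v; u \<notin> X; v \<notin> X\<rbrakk> \<Longrightarrow> perfectly_matched (insert u (insert v X))"

text \<open>The triple spans at least two edges. No centre is singled out; in particular each of the
  three vertices meets one of these edges.\<close>

definition path3 :: "'a \<Rightarrow> 'a \<Rightarrow> 'a \<Rightarrow> bool" where
  "path3 u v w \<longleftrightarrow> A u v \<and> A u w \<or> A u v \<and> A v w \<or> A u w \<and> A v w"

text \<open>Edge-stability seen on triples: an uncovered triple with at most one edge would, once
  that edge is deleted, leave a maximal matching that is too small.\<close>

definition locked :: "'a set \<Rightarrow> bool" where
  "locked W \<longleftrightarrow> (\<forall>u\<in>W. \<forall>v\<in>W. \<forall>w\<in>W. distinct [u, v, w] \<longrightarrow>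
     perfectly_matched (W - {u, v, w}) \<longrightarrow> path3 u v w)"

definition unbalanced_join :: "'a set \<Rightarrow> 'a set \<Rightarrow> bool" where
  "unbalanced_join S T \<longleftrightarrow> finite S \<and> finite T \<and> S \<inter> T = {} \<and> card T = card S + 1 \<and>
     (\<forall>s\<in>S. \<forall>s'\<in>S. \<not> A s s') \<and> (\<forall>s\<in>S. \<forall>t\<in>T. A s t)"

text \<open>A cherry here is a path of length two in the complement.\<close>
definition cherry_free :: "'a set \<Rightarrow> bool" where
  "cherry_free T \<longleftrightarrow> (\<forall>p\<in>T. \<forall>q\<in>T. \<forall>r\<in>T. distinct [p, q, r] \<longrightarrow> A p q \<or> A p r)"

lemma perfectly_matched_Un:
  assumes "perfectly_matched X" "perfectly_matched Y" "X \<inter> Y = {}"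
  shows "perfectly_matched (X \<union> Y)"
  using assms
proof (induction rule: perfectly_matched.induct)
  case (step X u v)
  then have "perfectly_matched (insert u (insert v (X \<union> Y)))"
    by (intro perfectly_matched.step) auto
  then show ?case by simp
qed simp

lemma perfectly_matched_edge: "A u v \<Longrightarrow> perfectly_matched {u, v}"
  using perfectly_matched.step[OF perfectly_matched.empty] by simp

lemma perfectly_matched_even: "perfectly_matched X \<Longrightarrow> finite X \<and> even (card X)"
proof (induction rule: perfectly_matched.induct)
  case (step X u v)
  then have "u \<noteq> v" using irrefl by blast
  then show ?case using step by simp
qed simp

lemma perfectly_matched_join:
  assumes "finite P" "finite Q" "card P = card Q" "P \<inter> Q = {}" "\<And>s t. s \<in> P \<Longrightarrow> t \<in> Q \<Longrightarrow> A s t"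
  shows "perfectly_matched (P \<union> Q)"
  using assms
proof (induction "card P" arbitrary: P Q)
  case 0
  then show ?case by (simp add: perfectly_matched.empty)
next
  case (Suc n)
  then obtain s t where s: "s \<in> P" and t: "t \<in> Q"
    by (metis card.empty ex_in_conv nat.distinct(1))
  have "perfectly_matched ((P - {s}) \<union> (Q - {t}))"
    using Suc.prems Suc.hyps(2) s t by (intro Suc.hyps(1)) auto
  then have "perfectly_matched (insert s (insert t ((P - {s}) \<union> (Q - {t}))))"
    using Suc.prems s t by (intro perfectly_matched.step) auto
  moreover have "insert s (insert t ((P - {s}) \<union> (Q - {t}))) = P \<union> Q"
    using s t by auto
  ultimately show ?case by simp
qed

lemma lockedD:
  assumes "locked W" "perfectly_matched X" "W = X \<union> {u, v, w}" "distinct [u, v, w]"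
    "X \<inter> {u, v, w} = {}"
  shows "path3 u v w"
proof -
  have "W - {u, v, w} = X" using assms by auto
  then show ?thesis using assms unfolding locked_def by auto
qed

text \<open>A perfect matching of \<open>X\<close> completes any matching inside \<open>W\<close>
  and leaves the same triple uncovered. Matched edges can thus be put aside and the remaining
  vertices studied alone.\<close>

lemma locked_subset:
  assumes "locked (W \<union> X)" "perfectly_matched X" "W \<inter> X = {}"
  shows "locked W"
  unfolding locked_def
proof (intro ballI impI)
  fix u v w assume *: "u \<in> W" "v \<in> W" "w \<in> W" "distinct [u, v, w]"
    "perfectly_matched (W - {u, v, w})"
  have "perfectly_matched ((W - {u, v, w}) \<union> X)"
    using assms * by (intro perfectly_matched_Un) auto
  then show "path3 u v w"
    by (rule lockedD[OF assms(1)]) (use assms * in auto)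
qed

text \<open>Match the two edges inside \<open>T\<close>, and match the other
  \<open>card T - 4\<close> vertices of \<open>T\<close> across the join. These are
  \<open>card S - 3\<close> in number, so three vertices of the independent set \<open>S\<close>
  stay uncovered.\<close>

lemma join_nu:
  assumes lo: "locked (S \<union> T)" and j: "unbalanced_join S T"
    and t: "t1 \<in> T" "t2 \<in> T" "t3 \<in> T" "t4 \<in> T" "distinct [t1, t2, t3, t4]"
    and e: "A t1 t2" "A t3 t4"
  shows False
proof -
  note j' = j[unfolded unbalanced_join_def]
  have "card {t1, t2, t3, t4} \<le> card T" using t j' by (intro card_mono) auto
  then have "3 \<le> card S" using t j' by simp
  then obtain S3 where S3: "S3 \<subseteq> S" "card S3 = 3" by (metis obtain_subset_with_card_n)
  then obtain s1 s2 s3 where s: "S3 = {s1, s2, s3}" "distinct [s1, s2, s3]"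
    by (auto simp: card_3_iff)
  have "perfectly_matched ((S - {s1, s2, s3}) \<union> (T - {t1, t2, t3, t4}))"
    using j' s S3 t by (intro perfectly_matched_join) (auto simp: card_Diff_subset)
  moreover have "perfectly_matched ({t1, t2} \<union> {t3, t4})"
    using t e by (intro perfectly_matched_Un[OF perfectly_matched_edge perfectly_matched_edge]) auto
  ultimately have "perfectly_matched (((S - {s1, s2, s3}) \<union> (T - {t1, t2, t3, t4})) \<union> ({t1, t2} \<union> {t3, t4}))"
    by (rule perfectly_matched_Un) (use t j' in auto)
  then have "path3 s1 s2 s3"
    by (rule lockedD[OF lo]) (use s S3 t j' in auto)
  then show False using j' s S3 unfolding path3_def by blast
qed

text \<open>On four vertices of a cherry-free \<open>T\<close> the non-edges form a matching, so two
  disjoint edges exist among them, against \<open>join_nu\<close>. This restores the cherry that the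
  next extension step requires.\<close>

lemma join_has_cherry:
  assumes lo: "locked (S \<union> T)" and j: "unbalanced_join S T" and c: "3 \<le> card S"
  shows "\<not> cherry_free T"
proof
  assume cf: "cherry_free T"
  have "4 \<le> card T" using j c unfolding unbalanced_join_def by simp
  then obtain Q where Q: "Q \<subseteq> T" "card Q = 4" by (metis obtain_subset_with_card_n)
  then obtain a P where "Q = insert a P" "a \<notin> P" "card P = 3"
    by (metis card_eq_SucD numeral_eq_Suc pred_numeral_simps(2) semiring_norm(26,27,28))
  then obtain a b c d where Qe: "Q = {a, b, c, d}" "distinct [a, b, c, d]"
    by (auto simp: card_3_iff)
  then have T: "a \<in> T" "b \<in> T" "c \<in> T" "d \<in> T" using Q by auto
  have n: "\<not> (A a b \<and> A c d)" "\<not> (A a c \<and> A b d)" "\<not> (A a d \<and> A b c)"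
    using join_nu[OF lo j T(1,2,3,4)] join_nu[OF lo j T(1,3,2,4)] join_nu[OF lo j T(1,4,2,3)] Qe
    by auto
  have cf': "\<And>p q r. p \<in> T \<Longrightarrow> q \<in> T \<Longrightarrow> r \<in> T \<Longrightarrow> distinct [p, q, r] \<Longrightarrow> A p q \<or> A p r"
    using cf unfolding cherry_free_def by blast
  have "A a b \<or> A a c" "A a b \<or> A a d" "A a c \<or> A a d" "A b a \<or> A b c" "A b a \<or> A b d" "A b c \<or> A b d"
    "A c a \<or> A c b" "A c a \<or> A c d" "A c b \<or> A c d" "A d a \<or> A d b" "A d a \<or> A d c" "A d b \<or> A d c"
    using cf'[OF T(1,2,3)] cf'[OF T(1,2,4)] cf'[OF T(1,3,4)] cf'[OF T(2,1,3)] cf'[OF T(2,1,4)]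
      cf'[OF T(2,3,4)] cf'[OF T(3,1,2)] cf'[OF T(3,1,4)] cf'[OF T(3,2,4)] cf'[OF T(4,1,2)]
      cf'[OF T(4,1,3)] cf'[OF T(4,2,3)] Qe(2) by auto
  then show False using n sym by blast
qed

subsection \<open>Extending a join by a matching edge\<close>

text \<open>The situation of one induction step: a join with a cherry in its larger side, and a
  matching edge between \<open>x\<close> and \<open>y\<close> that is to be absorbed.\<close>

definition extension :: "'a set \<Rightarrow> 'a set \<Rightarrow> 'a \<Rightarrow> 'a \<Rightarrow> bool" where
  "extension S T x y \<longleftrightarrow> unbalanced_join S T \<and> 2 \<le> card S \<and> \<not> cherry_free T \<and>
     x \<notin> S \<union> T \<and> y \<notin> S \<union> T \<and> A x y \<and> locked (S \<union> T \<union> {x, y})"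

lemma extension_swap: "extension S T x y \<Longrightarrow> extension S T y x"
  unfolding extension_def by (metis insert_commute sym)

lemma extension_neq: "extension S T x y \<Longrightarrow> x \<noteq> y"
  unfolding extension_def using irrefl by blast

lemma extension_locked: "extension S T x y \<Longrightarrow> locked (S \<union> T)"
  unfolding extension_def
  by (rule locked_subset[of _ "{x, y}"]) (auto intro: perfectly_matched_edge)

text \<open>The common device of the lemmas below: fix a small matching covering \<open>M\<close>,
  keep \<open>S0\<close> and \<open>T0\<close> free, and match the equally many remaining vertices
  of \<open>S\<close> and \<open>T\<close> across the join. What stays uncovered is
  \<open>S0\<close>, \<open>T0\<close> and whichever of \<open>x\<close>, \<open>y\<close> lie
  outside \<open>M\<close>.\<close>

lemma extension_path3:
  assumes ext: "extension S T x y" and M: "perfectly_matched M"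
    and M_sub: "M \<subseteq> S \<union> T \<union> {x, y}" and S0: "S0 \<subseteq> S - M" and T0: "T0 \<subseteq> T - M"
    and bal: "card (S - M - S0) = card (T - M - T0)"
    and rest: "S0 \<union> T0 \<union> ({x, y} - M) = {u, v, w}" and d: "distinct [u, v, w]"
  shows "path3 u v w"
proof -
  have j: "unbalanced_join S T" and lo: "locked (S \<union> T \<union> {x, y})" and xy: "x \<notin> S \<union> T" "y \<notin> S \<union> T"
    using ext unfolding extension_def by auto
  note j' = j[unfolded unbalanced_join_def]
  have "perfectly_matched ((S - M - S0) \<union> (T - M - T0))"
    using j' bal S0 T0 by (intro perfectly_matched_join) blast+
  then have "perfectly_matched (M \<union> ((S - M - S0) \<union> (T - M - T0)))"
    by (rule perfectly_matched_Un[OF M]) auto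
  then show ?thesis
    by (rule lockedD[OF lo]) (use d S0 T0 M_sub xy j' in \<open>auto simp: rest[symmetric]\<close>)
qed

lemma not_cherry_free:
  assumes "\<not> cherry_free T"
  obtains p q r where "p \<in> T" "q \<in> T" "r \<in> T" "distinct [p, q, r]" "\<not> A p q" "\<not> A p r"
    "\<not> A q p" "\<not> A r p"
proof -
  obtain p q r where *: "p \<in> T" "q \<in> T" "r \<in> T" "distinct [p, q, r]" "\<not> A p q" "\<not> A p r"
    using assms unfolding cherry_free_def by blast
  show thesis by (rule that[OF *]) (use * sym in blast)+
qed

section \<open>Adjacencies forced between the new edge and the join\<close>

context
  fixes S T x y assumes ext: "extension S T x y"
begin

lemma extension_join: "unbalanced_join S T"
  using ext unfolding extension_def by blast

lemma extension_facts:
  "finite S" "finite T" "S \<inter> T = {}" "card T = card S + 1" "2 \<le> card S"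
  "x \<notin> S" "x \<notin> T" "y \<notin> S" "y \<notin> T" "A x y" "x \<noteq> y" "locked (S \<union> T)"
  "\<And>s s'. s \<in> S \<Longrightarrow> s' \<in> S \<Longrightarrow> \<not> A s s'"
  "\<And>s t. s \<in> S \<Longrightarrow> t \<in> T \<Longrightarrow> A s t" "\<And>s t. s \<in> S \<Longrightarrow> t \<in> T \<Longrightarrow> A t s"
  using ext extension_neq[OF ext] extension_locked[OF ext] sym
  unfolding extension_def unbalanced_join_def by auto

lemma extension_distinct: "s \<in> S \<Longrightarrow> s \<noteq> x" "s \<in> S \<Longrightarrow> s \<noteq> y" "t \<in> T \<Longrightarrow> t \<noteq> x" "t \<in> T \<Longrightarrow> t \<noteq> y"
  "s \<in> S \<Longrightarrow> t \<in> T \<Longrightarrow> s \<noteq> t" "s \<in> S \<Longrightarrow> s \<notin> T" "t \<in> T \<Longrightarrow> t \<notin> S"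
  using extension_facts by auto

lemma path3_xS:
  assumes "s \<in> S" "A x s" "t \<in> T" "t' \<in> T" "t \<noteq> t'"
  shows "path3 y t t'"
proof (rule extension_path3[OF ext perfectly_matched_edge[OF assms(2)], of "{}" "{t, t'}"])
  show "card (S - {x, s} - {}) = card (T - {x, s} - {t, t'})"
    using assms extension_facts extension_distinct by (simp add: card_Diff_subset Diff_insert0)
qed (use assms extension_facts extension_distinct in auto)

text \<open>Matching \<open>x\<close> with \<open>t\<close> balances the two sides, so
  \<open>y\<close>, \<open>s\<close> and \<open>t'\<close> can be left uncovered, and two edges on
  three vertices must meet \<open>y\<close>.\<close>

lemma adj_xT:
  assumes "t \<in> T" "A x t" "s \<in> S" "t' \<in> T" "t' \<noteq> t"
  shows "A y s \<or> A y t'"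
proof -
  have "path3 y s t'"
  proof (rule extension_path3[OF ext perfectly_matched_edge[OF assms(2)], of "{s}" "{t'}"])
    show "card (S - {x, t} - {s}) = card (T - {x, t} - {t'})"
      using assms extension_facts extension_distinct by (simp add: card_Diff_subset Diff_insert0)
  qed (use assms extension_facts extension_distinct in auto)
  then show ?thesis unfolding path3_def by blast
qed

text \<open>Using up two vertices of \<open>S\<close> makes \<open>T\<close> larger by three.
  Applied to a cherry of \<open>T\<close>, this forbids \<open>x\<close> and \<open>y\<close> to
  have distinct neighbours in \<open>S\<close>.\<close>

lemma path3_xS_yS:
  assumes "s \<in> S" "A x s" "s' \<in> S" "A y s'" "s \<noteq> s'"
    and "p \<in> T" "q \<in> T" "r \<in> T" "distinct [p, q, r]"
  shows "path3 p q r"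
proof (rule extension_path3[OF ext, of "{x, s} \<union> {y, s'}" "{}" "{p, q, r}"])
  show "perfectly_matched ({x, s} \<union> {y, s'})"
    using assms extension_facts extension_distinct
    by (intro perfectly_matched_Un[OF perfectly_matched_edge perfectly_matched_edge]) auto
  have "{p, q, r} \<subseteq> T" "card {p, q, r} = 3" using assms by auto
  then show "card (S - ({x, s} \<union> {y, s'}) - {}) = card (T - ({x, s} \<union> {y, s'}) - {p, q, r})"
    using assms extension_facts extension_distinct by (simp add: card_Diff_subset Diff_insert0)
qed (use assms extension_facts extension_distinct in auto)

text \<open>The edges \<open>t1 t2\<close> and \<open>x l\<close> use three vertices of
  \<open>T\<close>, so two vertices of \<open>S\<close> are left over with \<open>y\<close>. As
  these two are nonadjacent, \<open>y\<close> is adjacent to both.\<close>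

lemma adj_yS:
  assumes "A t1 t2" "t1 \<in> T" "t2 \<in> T" "l \<in> T" "l \<noteq> t1" "l \<noteq> t2" "A x l" "s \<in> S"
  shows "A y s"
proof -
  have "t1 \<noteq> t2" using assms(1) irrefl by blast
  have "S \<noteq> {s}" using extension_facts(5) by auto
  then obtain s' where s': "s' \<in> S" "s' \<noteq> s" using assms(8) by blast
  have "path3 y s s'"
  proof (rule extension_path3[OF ext, of "{t1, t2} \<union> {x, l}" "{s, s'}" "{}"])
    show "perfectly_matched ({t1, t2} \<union> {x, l})"
      using assms extension_facts extension_distinct
      by (intro perfectly_matched_Un[OF perfectly_matched_edge perfectly_matched_edge]) auto
    show "card (S - ({t1, t2} \<union> {x, l}) - {s, s'}) = card (T - ({t1, t2} \<union> {x, l}) - {})"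
      using assms s' extension_facts extension_distinct \<open>t1 \<noteq> t2\<close> by (simp add: card_Diff_subset Diff_insert0)
  qed (use assms s' extension_facts extension_distinct in auto)
  then show ?thesis using extension_facts(13)[OF assms(8) s'(1)] unfolding path3_def by blast
qed

lemma path3_xy:
  assumes "t \<in> T"
  shows "path3 x y t"
proof (rule extension_path3[OF ext perfectly_matched.empty, of "{}" "{t}"])
  show "card (S - {} - {}) = card (T - {} - {t})"
    using assms extension_facts by simp
qed (use assms extension_facts extension_distinct in auto)

end

section \<open>Building the larger join case by case\<close>

lemma distinct3_avoid:
  assumes "distinct [p, q, r]"
  obtains w where "w \<in> {p, q, r}" "w \<noteq> u" "w \<noteq> v"
  using assms by (cases "p = u \<or> p = v"; cases "q = u \<or> q = v") auto

lemma unbalanced_joinI: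
  assumes "finite S" "finite T" "S \<inter> T = {}" "card T = card S + 1"
    "\<And>s s'. s \<in> S \<Longrightarrow> s' \<in> S \<Longrightarrow> \<not> A s s'" "\<And>s t. s \<in> S \<Longrightarrow> t \<in> T \<Longrightarrow> A s t"
  shows "unbalanced_join S T"
  using assms unfolding unbalanced_join_def by blast

text \<open>By \<open>path3_xS\<close> the triple \<open>y\<close>, \<open>t\<close>,
  \<open>t'\<close> spans two edges; when \<open>t\<close> and \<open>t'\<close> are nonadjacent,
  both must be at \<open>y\<close>.\<close>

lemma adj_y_noncherry:
  assumes ext: "extension S T x y" and s: "s \<in> S" "A x s"
    and t: "t \<in> T" "t' \<in> T" "t \<noteq> t'" "\<not> A t t'"
  shows "A y t"
  using path3_xS[OF ext s t(1-3)] t(4) unfolding path3_def by blast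

lemma extension_cherry:
  assumes "extension S T x y"
  obtains p q r where "p \<in> T" "q \<in> T" "r \<in> T" "distinct [p, q, r]" "\<not> A p q" "\<not> A p r"
    "\<not> A q p" "\<not> A r p"
  using assms not_cherry_free unfolding extension_def by blast

text \<open>The centre \<open>p\<close> of a cherry and its non-neighbour \<open>q\<close> cannot
  both lie on the edge, so one of them is off it and has the other as a non-neighbour.\<close>

lemma nonneighbour_off_edge:
  assumes ext: "extension S T x y" and e: "A t1 t2" "t1 \<in> T" "t2 \<in> T"
  obtains u v where "u \<in> T" "u \<noteq> t1" "u \<noteq> t2" "v \<in> T" "u \<noteq> v" "\<not> A u v"
proof -
  obtain p q r where pqr: "p \<in> T" "q \<in> T" "distinct [p, q, r]" "\<not> A p q" "\<not> A q p"
    using extension_cherry[OF ext] by blast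
  show thesis
  proof (cases "p = t1 \<or> p = t2")
    case True
    then show thesis using pqr e sym by (intro that[of q p]) auto
  next
    case False
    then show thesis using pqr by (intro that[of p q]) auto
  qed
qed

text \<open>A neighbour of \<open>x\<close> in \<open>S\<close> makes \<open>y\<close> complete to
  \<open>T\<close>, and then \<open>x\<close> is complete to \<open>S\<close> or to
  \<open>T\<close>. In the first case \<open>y\<close> joins \<open>S\<close> and \<open>x\<close>
  joins \<open>T\<close>; in the second, \<open>T\<close> becomes the independent side and
  \<open>x\<close>, \<open>y\<close> move to the side of \<open>S\<close>.\<close>

lemma extend_independent_S:
  assumes ext: "extension S T x y" and ind: "\<And>t t'. t \<in> T \<Longrightarrow> t' \<in> T \<Longrightarrow> \<not> A t t'"
    and s: "s \<in> S" "A x s"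
  shows "\<exists>S' T'. unbalanced_join S' T' \<and> S' \<union> T' = S \<union> T \<union> {x, y}"
proof -
  note j = extension_facts[OF ext]
  obtain p q r where pqr: "p \<in> T" "q \<in> T" "r \<in> T" "distinct [p, q, r]"
    using extension_cherry[OF ext] by blast
  have other: "\<exists>t'\<in>T. t' \<noteq> t" for t
    using pqr by (cases "t = p") auto
  have yT: "A y t" if "t \<in> T" for t
    using other[of t] adj_y_noncherry[OF ext s that] ind that by blast
  \<comment> \<open>This is \<open>adj_xT\<close> with \<open>x\<close> and \<open>y\<close>
    interchanged, started from the edge between \<open>y\<close> and a vertex of \<open>T\<close>
    other than \<open>t'\<close>.\<close>
  have xST: "A x s' \<or> A x t'" if "s' \<in> S" "t' \<in> T" for s' t'
    using other[of t'] adj_xT[OF extension_swap[OF ext] _ yT that] that by blast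
  show ?thesis
  proof (cases "\<forall>s'\<in>S. A x s'")
    case True
    have yS: "\<not> A y s'" if s': "s' \<in> S" for s'
    proof
      assume "A y s'"
      have "S \<noteq> {s'}" using j(5) by auto
      then obtain s'' where "s'' \<in> S" "s'' \<noteq> s'" using s' by blast
      then have "path3 p q r"
        using path3_xS_yS[OF ext _ _ s' \<open>A y s'\<close> _ pqr] True by blast
      then show False using ind pqr unfolding path3_def by blast
    qed
    have "unbalanced_join (insert y S) (insert x T)"
    proof (rule unbalanced_joinI)
      show "\<not> A a b" if "a \<in> insert y S" "b \<in> insert y S" for a b
        using that j(13) yS irrefl sym by blast
      show "A a b" if "a \<in> insert y S" "b \<in> insert x T" for a b
        using that j(10,14) yT True sym by blast
    qed (use j(1-9,11) in auto)
    then show ?thesis by fastforce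
  next
    case False
    then have xT: "A x t" if "t \<in> T" for t using xST that by blast
    have "unbalanced_join T (S \<union> {x, y})"
    proof (rule unbalanced_joinI)
      show "A a b" if "a \<in> T" "b \<in> S \<union> {x, y}" for a b
        using that j(15) xT yT sym by blast
    qed (use j(1-9,11) ind in auto)
    then show ?thesis by fastforce
  qed
qed

lemma extend_independent:
  assumes ext: "extension S T x y" and ind: "\<And>t t'. t \<in> T \<Longrightarrow> t' \<in> T \<Longrightarrow> \<not> A t t'"
  shows "\<exists>S' T'. unbalanced_join S' T' \<and> S' \<union> T' = S \<union> T \<union> {x, y}"
proof (cases "\<exists>s\<in>S. A x s \<or> A y s")
  case True
  then show ?thesis
    using extend_independent_S[OF ext ind] extend_independent_S[OF extension_swap[OF ext] ind]
    by (metis insert_commute)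
next
  case False
  note j = extension_facts[OF ext]
  obtain p q r where pqr: "p \<in> T" "q \<in> T" "r \<in> T" "distinct [p, q, r]"
    using extension_cherry[OF ext] by blast
  obtain s where s: "s \<in> S" using j(5) by fastforce
  have step: "A y t'" if "A x t" "t \<in> T" "t' \<in> T" "t' \<noteq> t" for t t'
    using adj_xT[OF ext that(2,1) s that(3,4)] False s by blast
  have step': "A x t'" if "A y t" "t \<in> T" "t' \<in> T" "t' \<noteq> t" for t t'
    using adj_xT[OF extension_swap[OF ext] that(2,1) s that(3,4)] False s by blast
  have "A x p \<or> A y p"
    using path3_xy[OF ext pqr(1)] unfolding path3_def by blast
  \<comment> \<open>Moving to another vertex of \<open>T\<close> exchanges \<open>x\<close> and
    \<open>y\<close>. Going from \<open>u\<close> to \<open>t\<close> directly and through the third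
    vertex \<open>w\<close> therefore yields both adjacencies.\<close>
  then have all: "A x t \<and> A y t" if t: "t \<in> T" for t
  proof -
    obtain u where u: "u \<in> T" "u \<noteq> p" "u \<noteq> t"
      using distinct3_avoid[OF pqr(4), of p t] pqr(1-3) by blast
    obtain w where w: "w \<in> T" "w \<noteq> u" "w \<noteq> t"
      using distinct3_avoid[OF pqr(4), of u t] pqr(1-3) by blast
    from \<open>A x p \<or> A y p\<close> have "A x u \<or> A y u"
      using step[of p u] step'[of p u] u pqr(1) by blast
    moreover have "A x u \<Longrightarrow> A y t" "A y u \<Longrightarrow> A x t" "A x u \<Longrightarrow> A y w" "A y u \<Longrightarrow> A x w"
      "A x w \<Longrightarrow> A y t" "A y w \<Longrightarrow> A x t"
      using step step' u w t by blast+
    ultimately show ?thesis by blast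
  qed
  have "unbalanced_join T (S \<union> {x, y})"
  proof (rule unbalanced_joinI)
    show "A a b" if "a \<in> T" "b \<in> S \<union> {x, y}" for a b
      using that j(15) all sym by blast
  qed (use j(1-9,11) ind in auto)
  then show ?thesis by fastforce
qed

text \<open>The edge \<open>x l\<close> avoiding \<open>t1 t2\<close> forces \<open>y\<close> to be
  complete to \<open>S\<close> and \<open>x\<close> to be adjacent to every vertex of
  \<open>T\<close> with a non-neighbour in \<open>T\<close>. If \<open>x\<close> is complete to
  \<open>T\<close>, then \<open>x\<close> joins \<open>S\<close> and \<open>y\<close> joins
  \<open>T\<close>. Otherwise a vertex \<open>c\<close> of \<open>T\<close> not adjacent to
  \<open>x\<close> is adjacent to all the rest of \<open>T\<close>.\<close>

lemma extend_edge_L: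
  assumes ext: "extension S T x y" and e: "A t1 t2" "t1 \<in> T" "t2 \<in> T"
    and l: "l \<in> T" "l \<noteq> t1" "l \<noteq> t2" and xl: "A x l"
  shows "\<exists>S' T'. unbalanced_join S' T' \<and> S' \<union> T' = S \<union> T \<union> {x, y}"
proof -
  note j = extension_facts[OF ext] and ext' = extension_swap[OF ext]
  obtain p q r where pqr: "p \<in> T" "q \<in> T" "r \<in> T" "distinct [p, q, r]"
      "\<not> A p q" "\<not> A p r" "\<not> A q p" "\<not> A r p"
    using extension_cherry[OF ext] by blast
  obtain s where s: "s \<in> S" using j(5) by fastforce
  have yS: "A y s'" if "s' \<in> S" for s'
    by (rule adj_yS[OF ext e l xl that])
  have xT: "A x t" if "t \<in> T" "t' \<in> T" "t \<noteq> t'" "\<not> A t t'" for t t'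
    by (rule adj_y_noncherry[OF ext' s yS[OF s] that])
  \<comment> \<open>A neighbour of \<open>y\<close> off some edge of \<open>T\<close> would make
    \<open>x\<close> complete to \<open>S\<close> as well. Then \<open>x\<close> and
    \<open>y\<close> could be matched to distinct vertices of \<open>S\<close>, leaving the cherry
    \<open>p\<close>, \<open>q\<close>, \<open>r\<close> uncovered.\<close>
  have y_off: "\<not> A y l'"
    if "A u v" "u \<in> T" "v \<in> T" "l' \<in> T" "l' \<noteq> u" "l' \<noteq> v" for u v l'
  proof
    assume yl: "A y l'"
    have xS: "A x s'" if "s' \<in> S" for s'
      by (rule adj_yS[OF ext' \<open>A u v\<close> \<open>u \<in> T\<close> \<open>v \<in> T\<close> \<open>l' \<in> T\<close> \<open>l' \<noteq> u\<close> \<open>l' \<noteq> v\<close> yl that])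
    have "S \<noteq> {s}" using j(5) by auto
    then obtain s' where s': "s' \<in> S" "s' \<noteq> s" using s by blast
    have "path3 p q r"
      using path3_xS_yS[OF ext s xS[OF s] s'(1) yS[OF s'(1)] s'(2)[symmetric] pqr(1-4)] .
    then show False using pqr unfolding path3_def by blast
  qed
  obtain u v where nonnbr: "u \<in> T" "u \<noteq> t1" "u \<noteq> t2" "v \<in> T" "u \<noteq> v" "\<not> A u v"
    using nonneighbour_off_edge[OF ext e] by blast
  have xS: "\<not> A x s'" if "s' \<in> S" for s'
  proof
    assume "A x s'"
    then show False
      using adj_y_noncherry[OF ext that _ nonnbr(1,4-6)] y_off[OF e nonnbr(1-3)] by blast
  qed
  show ?thesis
  proof (cases "\<forall>t\<in>T. A x t")
    case True
    have "unbalanced_join (insert x S) (insert y T)"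
    proof (rule unbalanced_joinI)
      show "\<not> A a b" if "a \<in> insert x S" "b \<in> insert x S" for a b
        using that j(13) xS irrefl sym by blast
      show "A a b" if "a \<in> insert x S" "b \<in> insert y T" for a b
        using that j(10,14) yS True sym by blast
    qed (use j(1-9,11) in auto)
    then show ?thesis by fastforce
  next
    case False
    txt \<open>Here \<open>T\<close> spans a star with centre \<open>c\<close>, and the roles of the two sides are exchanged.\<close>
    then obtain c where c: "c \<in> T" "\<not> A x c" by blast
    have cT: "A c t" "A t c" if "t \<in> T" "t \<noteq> c" for t
      using xT[OF c(1) that(1)] that c(2) sym by blast+
    have pc: "p \<noteq> c" "q \<noteq> c" "r \<noteq> c" using pqr cT by auto
    \<comment> \<open>An edge \<open>u v\<close> away from \<open>c\<close> would be disjoint from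
      an edge \<open>c w\<close>, which \<open>join_nu\<close> excludes.\<close>
    have ind: "\<not> A u v" if uv: "u \<in> T" "v \<in> T" "u \<noteq> c" "v \<noteq> c" for u v
    proof
      assume "A u v"
      then have "u \<noteq> v" using irrefl by blast
      obtain w where w: "w \<in> T" "w \<noteq> c" "w \<noteq> u" "w \<noteq> v"
        using distinct3_avoid[OF pqr(4), of u v] pqr(1-3) pc by blast
      show False
        by (rule join_nu[OF j(12) extension_join[OF ext] uv(1,2) c(1) w(1) _ \<open>A u v\<close> cT(1)[OF w(1,2)]])
          (use uv w \<open>u \<noteq> v\<close> in auto)
    qed
    have yc: "A y c" using path3_xy[OF ext c(1)] c(2) unfolding path3_def by blast
    have yT: "\<not> A y u" if u: "u \<in> T" "u \<noteq> c" for u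
    proof -
      obtain v where v: "v \<in> T" "v \<noteq> c" "v \<noteq> u"
        using distinct3_avoid[OF pqr(4), of u u] pqr(1-3) pc by blast
      show ?thesis
        by (rule y_off[OF cT(1)[OF v(1,2)] c(1) v(1) u(1)]) (use u v in auto)
    qed
    have xT': "A x u" if u: "u \<in> T" "u \<noteq> c" for u
    proof -
      obtain v where v: "v \<in> T" "v \<noteq> c" "v \<noteq> u"
        using distinct3_avoid[OF pqr(4), of u u] pqr(1-3) pc by blast
      show ?thesis by (rule xT[OF u(1) v(1)]) (use ind u v in auto)
    qed
    have "unbalanced_join (insert y (T - {c})) (insert c (insert x S))"
    proof (rule unbalanced_joinI)
      show "\<not> A a b" if "a \<in> insert y (T - {c})" "b \<in> insert y (T - {c})" for a b
        using that ind yT irrefl sym by blast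
      show "A a b" if "a \<in> insert y (T - {c})" "b \<in> insert c (insert x S)" for a b
        using that j(10,15) yS xT' yc cT(2) sym by blast
      have "c \<noteq> x" "c \<notin> S" "card T \<noteq> 0"
        using c(1) j(2,3,7) by auto
      then show "card (insert c (insert x S)) = card (insert y (T - {c})) + 1"
        using j(1-9) c(1) by (simp add: card_Diff_singleton)
    qed (use j(1-9,11) c(1) in auto)
    moreover have "insert y (T - {c}) \<union> insert c (insert x S) = S \<union> T \<union> {x, y}"
      using c by auto
    ultimately show ?thesis by blast
  qed
qed

lemma extend:
  assumes ext: "extension S T x y"
  shows "\<exists>S' T'. unbalanced_join S' T' \<and> S' \<union> T' = S \<union> T \<union> {x, y}"
proof (cases "\<forall>t\<in>T. \<forall>t'\<in>T. \<not> A t t'")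
  case True
  then show ?thesis using extend_independent[OF ext] by blast
next
  case False
  then obtain t1 t2 where e: "A t1 t2" "t1 \<in> T" "t2 \<in> T" by blast
  note j = extension_facts[OF ext] and ext' = extension_swap[OF ext]
  show ?thesis
  proof (cases "\<exists>l\<in>T - {t1, t2}. A x l \<or> A y l")
    case True
    then obtain l where l: "l \<in> T" "l \<noteq> t1" "l \<noteq> t2" "A x l \<or> A y l" by blast
    then show ?thesis
      using extend_edge_L[OF ext e l(1-3)] extend_edge_L[OF ext' e l(1-3)]
      by (metis insert_commute)
  next
    \<comment> \<open>This case is contradictory: \<open>x\<close> and \<open>y\<close> would have
      no neighbour in \<open>S\<close> or \<open>T\<close>, so \<open>x\<close>, \<open>y\<close>
      and \<open>t1\<close> would span a single edge.\<close>
    case False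
    then have off: "\<not> A x l" "\<not> A y l" if "l \<in> T" "l \<noteq> t1" "l \<noteq> t2" for l
      using that by blast+
    obtain p q r where pqr: "p \<in> T" "q \<in> T" "r \<in> T" "distinct [p, q, r]"
      "\<not> A p q" "\<not> A p r" "\<not> A q p" "\<not> A r p"
      using extension_cherry[OF ext] by blast
    obtain u v where u: "u \<in> T" "u \<noteq> t1" "u \<noteq> t2" "v \<in> T" "u \<noteq> v" "\<not> A u v"
      using pqr e sym by (metis distinct_length_2_or_more)
    obtain s where s: "s \<in> S" using j(5) by fastforce
    have S: "\<not> A x s" "\<not> A y s"
      using adj_y_noncherry[OF ext s _ u(1,4-6)] adj_y_noncherry[OF ext' s _ u(1,4-6)] off[OF u(1-3)]
      by blast+
    have "\<not> A x t" "\<not> A y t" if "t \<in> T" for t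
      using adj_xT[OF ext that _ s u(1)] adj_xT[OF ext' that _ s u(1)] S off[OF u(1-3)] by blast+
    then show ?thesis using path3_xy[OF ext e(2)] e(2) unfolding path3_def by blast
  qed
qed

subsection \<open>Five and seven vertices\<close>

lemma path3_5:
  assumes "locked {u, v, w, p, q}" "distinct [u, v, w, p, q]" "A p q"
  shows "path3 u v w"
  by (rule lockedD[OF assms(1) perfectly_matched_edge[OF assms(3)]]) (use assms(2) in auto)

lemma path3_7:
  assumes "locked W" "W = {u, v, w, p, q, r, s}" "distinct [u, v, w, p, q, r, s]" "A p q" "A r s"
  shows "path3 u v w"
proof (rule lockedD[OF assms(1)])
  show "perfectly_matched ({p, q} \<union> {r, s})"
    using assms by (intro perfectly_matched_Un[OF perfectly_matched_edge perfectly_matched_edge]) auto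
qed (use assms in auto)

definition five_cycle :: "'a \<Rightarrow> 'a \<Rightarrow> 'a \<Rightarrow> 'a \<Rightarrow> 'a \<Rightarrow> bool" where
  "five_cycle a b c d e \<longleftrightarrow> distinct [a, b, c, d, e] \<and>
     A a b \<and> A b c \<and> A c d \<and> A d e \<and> A e a \<and>
     \<not> A a c \<and> \<not> A b d \<and> \<not> A c e \<and> \<not> A d a \<and> \<not> A e b"

lemma five_cycle_rotate: "five_cycle a b c d e \<Longrightarrow> five_cycle b c d e a"
  unfolding five_cycle_def using sym by auto

text \<open>With three non-edges given, seven pairs are undecided. Each of them, if present as an
  edge, forces two edges on the complementary triple; starting from any edge these implications
  leave only the three stated configurations.\<close>

lemma locked_5:
  assumes lo: "locked {a, b, c, d, e}" and d: "distinct [a, b, c, d, e]"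
    and non: "\<not> A a b" "\<not> A a c" "\<not> A d e"
    and edge: "\<exists>u\<in>{a, b, c, d, e}. \<exists>v\<in>{a, b, c, d, e}. A u v"
  shows "unbalanced_join {d, e} {a, b, c} \<or> five_cycle a d b c e \<or> five_cycle a d c b e"
proof -
  have P: "A p q \<Longrightarrow> path3 u v w"
    if "{u, v, w, p, q} = {a, b, c, d, e}" "distinct [u, v, w, p, q]" for u v w p q
    using path3_5[of u v w p q] lo that by simp
  \<comment> \<open>Fixing one orientation per pair turns the remaining argument into propositional
    logic.\<close>
  have s: "A b a = A a b" "A c a = A a c" "A d a = A a d" "A e a = A a e" "A c b = A b c"
    "A d b = A b d" "A e b = A b e" "A d c = A c d" "A e c = A c e" "A e d = A d e"
    using sym by blast+
  have p: "A b c \<Longrightarrow> path3 a d e" "A a d \<Longrightarrow> path3 b c e" "A a e \<Longrightarrow> path3 b c d"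
    "A b d \<Longrightarrow> path3 a c e" "A b e \<Longrightarrow> path3 a c d" "A c d \<Longrightarrow> path3 a b e" "A c e \<Longrightarrow> path3 a b d"
    using P[of a d e b c] P[of b c e a d] P[of b c d a e] P[of a c e b d] P[of a c d b e]
      P[of a b e c d] P[of a b d c e] d by (auto simp: insert_commute)
  have "A b c \<or> A a d \<or> A a e \<or> A b d \<or> A b e \<or> A c d \<or> A c e"
    using edge non irrefl s by auto
  then have "(A a d \<and> A a e \<and> A b d \<and> A b e \<and> A c d \<and> A c e)
    \<or> (A a d \<and> A b d \<and> A b c \<and> A c e \<and> A a e \<and> \<not> A b e \<and> \<not> A c d)
    \<or> (A a d \<and> A c d \<and> A b c \<and> A b e \<and> A a e \<and> \<not> A c e \<and> \<not> A b d)"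
    using p non unfolding path3_def s by argo
  then show ?thesis
  proof (elim disjE)
    assume "A a d \<and> A a e \<and> A b d \<and> A b e \<and> A c d \<and> A c e"
    then have "unbalanced_join {d, e} {a, b, c}"
      using d non s irrefl by (intro unbalanced_joinI) auto
    then show ?thesis ..
  qed (use d non s in \<open>auto simp: five_cycle_def\<close>)
qed

lemma five_cycle_no_extension:
  assumes cyc: "five_cycle a b c d e" and lo: "locked {a, b, c, d, e, x, y}"
    and d: "distinct [a, b, c, d, e, x, y]" and xy: "A x y"
  shows False
proof -
  have P: "A p q \<Longrightarrow> A r s \<Longrightarrow> path3 u v w"
    if "{a, b, c, d, e, x, y} = {u, v, w, p, q, r, s}" "distinct [u, v, w, p, q, r, s]"
    for u v w p q r s
    using path3_7[OF lo, of u v w p q r s] that by blast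
  \<comment> \<open>Match \<open>x'\<close> with \<open>a'\<close> and \<open>c'\<close> with
    \<open>d'\<close>. The uncovered \<open>b'\<close> and \<open>e'\<close> are nonadjacent, so
    both edges of the triple are at \<open>y'\<close>. Stated for a generic labelling, so that it
    applies to all rotations and to both ends of the new edge.\<close>
  have nbrs: "A y' b' \<and> A y' e'"
    if "five_cycle a' b' c' d' e'" "{a', b', c', d', e'} = {a, b, c, d, e}" "{x', y'} = {x, y}"
      "A x' a'" for a' b' c' d' e' x' y'
  proof -
    have eq: "{a, b, c, d, e, x, y} = {y', b', e', x', a', c', d'}"
      using that(2,3) by blast
    have "card {a, b, c, d, e, x, y} = 7" using d by simp
    then have "distinct [y', b', e', x', a', c', d']"
      by (intro card_distinct) (simp add: eq)
    then have "path3 y' b' e'"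
      by (rule path3_7[OF lo eq _ that(4)]) (use that(1) in \<open>simp add: five_cycle_def\<close>)
    then show ?thesis using that sym unfolding five_cycle_def path3_def by blast
  qed
  have c2: "five_cycle b c d e a" by (rule five_cycle_rotate[OF cyc])
  have c3: "five_cycle c d e a b" by (rule five_cycle_rotate[OF c2])
  have c4: "five_cycle d e a b c" by (rule five_cycle_rotate[OF c3])
  have c5: "five_cycle e a b c d" by (rule five_cycle_rotate[OF c4])
  have sets: "{b, c, d, e, a} = {a, b, c, d, e}" "{c, d, e, a, b} = {a, b, c, d, e}"
    "{d, e, a, b, c} = {a, b, c, d, e}" "{e, a, b, c, d} = {a, b, c, d, e}" "{y, x} = {x, y}"
    by auto
  note n = nbrs[OF cyc refl refl] nbrs[OF c2 sets(1) refl] nbrs[OF c3 sets(2) refl]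
    nbrs[OF c4 sets(3) refl] nbrs[OF c5 sets(4) refl] nbrs[OF cyc refl sets(5)]
    nbrs[OF c2 sets(1,5)] nbrs[OF c3 sets(2,5)] nbrs[OF c4 sets(3,5)] nbrs[OF c5 sets(4,5)]
  have "path3 x y a"
    using cyc d by (intro path3_7[OF lo, of x y a b c d e]) (auto simp: five_cycle_def)
  then have "A x a \<or> A y a" unfolding path3_def by blast
  \<comment> \<open>Each use of \<open>n\<close> passes to the two neighbours on the cycle and
    exchanges \<open>x\<close> and \<open>y\<close>; since the cycle is odd, both become adjacent to
    every cycle vertex.\<close>
  then have "A x a \<and> A y c" using n by blast
  \<comment> \<open>On this triple only \<open>d e\<close> is an edge, because \<open>b d\<close>
    and \<open>e b\<close> are chords.\<close>
  then have "path3 b d e"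
    using d by (intro path3_7[OF lo, of b d e x a y c]) auto
  then show False using cyc sym unfolding five_cycle_def path3_def by blast
qed

lemma five_cycle_matched:
  assumes cyc: "five_cycle a b c d e" and X: "perfectly_matched X" "X \<noteq> {}"
    and lo: "locked ({a, b, c, d, e} \<union> X)" and disj: "{a, b, c, d, e} \<inter> X = {}"
  shows False
  using X(1)
proof cases
  case empty
  then show False using X(2) by simp
next
  case (step X' u v)
  have "u \<noteq> v" using step irrefl by blast
  have eq: "{a, b, c, d, e} \<union> X = {a, b, c, d, e, u, v} \<union> X'"
    unfolding step(1) by auto
  have "locked {a, b, c, d, e, u, v}"
    using lo unfolding eq by (rule locked_subset) (use step disj in auto)
  then show False
    by (rule five_cycle_no_extension[OF cyc _ _ step(3)])
      (use cyc step(1) disj \<open>u \<noteq> v\<close> in \<open>auto simp: five_cycle_def\<close>)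
qed

section \<open>From five vertices to the whole graph\<close>

lemma unbalanced_join_extend_all:
  assumes "perfectly_matched X" "locked (S \<union> T \<union> X)" "(S \<union> T) \<inter> X = {}"
    "unbalanced_join S T" "2 \<le> card S" "\<not> cherry_free T"
  shows "\<exists>S' T'. unbalanced_join S' T' \<and> S' \<union> T' = S \<union> T \<union> X"
  using assms
proof (induction arbitrary: S T rule: perfectly_matched.induct)
  case empty
  then show ?case by auto
next
  case (step X u v)
  have "u \<noteq> v" using step irrefl by blast
  have lo: "locked (S \<union> T \<union> {u, v})"
    by (rule locked_subset[of _ X]) (use step in \<open>auto simp: Un_assoc insert_commute\<close>)
  have "extension S T u v"
    unfolding extension_def using step lo by auto
  then obtain S' T' where j: "unbalanced_join S' T'" and eq: "S' \<union> T' = S \<union> T \<union> {u, v}"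
    using extend by blast
  \<comment> \<open>Two more vertices and the same excess of one give
    \<open>card S' = card S + 1\<close>, hence at least three, as \<open>join_has_cherry\<close>
    demands.\<close>
  have "card (S' \<union> T') = card (S \<union> T) + 2"
    unfolding eq using step.prems \<open>u \<noteq> v\<close> unfolding unbalanced_join_def by auto
  then have "card S' + card T' = card S + card T + 2"
    using j step.prems(3) unfolding unbalanced_join_def by (simp add: card_Un_disjoint)
  then have c: "3 \<le> card S'"
    using j step.prems(3,4) unfolding unbalanced_join_def by simp
  have "\<not> cherry_free T'"
    using join_has_cherry[OF _ j c] lo eq by simp
  moreover have "S \<union> T \<union> insert u (insert v X) = S' \<union> T' \<union> X"
    unfolding eq by auto
  ultimately show ?case
    using step.IH[of S' T'] step.prems(1,2) step.hyps j c eq by auto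
qed

lemma locked_cases:
  assumes fin: "finite V" and odd: "odd (card V)" and c7: "7 \<le> card V" and lo: "locked V"
    and edge: "\<And>I. I \<subseteq> V \<Longrightarrow> 3 \<le> card I \<Longrightarrow> perfectly_matched (V - I) \<Longrightarrow> \<exists>u\<in>I. \<exists>v\<in>I. A u v"
    and ch: "\<not> cherry_free V"
  shows "\<exists>S T. unbalanced_join S T \<and> S \<union> T = V"
proof -
  \<comment> \<open>A largest such \<open>X\<close> is taken: matching any further edge outside it
    must destroy every remaining cherry.\<close>
  define P where "P X \<longleftrightarrow> perfectly_matched X \<and> X \<subseteq> V \<and> \<not> cherry_free (V - X)" for X
  have "P {}" unfolding P_def using ch by (simp add: perfectly_matched.empty)
  moreover have "\<forall>X. P X \<longrightarrow> card X < Suc (card V)"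
    unfolding P_def using fin by (simp add: card_mono less_Suc_eq_le)
  ultimately have "\<exists>X. P X \<and> (\<forall>Y. P Y \<longrightarrow> card Y \<le> card X)"
    by (rule ex_has_greatest_nat)
  then obtain X where X: "P X" and max: "\<And>Y. P Y \<Longrightarrow> card Y \<le> card X"
    by blast
  have pX: "perfectly_matched X" and XV: "X \<subseteq> V" using X unfolding P_def by auto
  have finX: "finite X" using fin XV finite_subset by blast
  have no_more: "cherry_free (V - X - {u, v})" if uv: "u \<in> V - X" "v \<in> V - X" "A u v" for u v
  proof (rule ccontr)
    assume nc: "\<not> ?thesis"
    have "u \<noteq> v" using uv irrefl by blast
    have "V - insert u (insert v X) = V - X - {u, v}" by auto
    then have "P (insert u (insert v X))"
      unfolding P_def using pX XV uv nc by (auto intro: perfectly_matched.step)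
    then have "card (insert u (insert v X)) \<le> card X" by (rule max)
    then show False using finX uv \<open>u \<noteq> v\<close> by simp
  qed
  obtain a b c where abc: "a \<in> V - X" "b \<in> V - X" "c \<in> V - X" "distinct [a, b, c]"
      "\<not> A a b" "\<not> A a c"
    using X unfolding P_def cherry_free_def by blast
  define U where "U = V - X - {a, b, c}"
  have cU: "card V = card X + 3 + card U"
  proof -
    have "card (V - X) = card V - card X" "card X \<le> card V"
      using fin XV by (auto simp: card_Diff_subset finX card_mono)
    moreover have "card U = card (V - X) - 3" "3 \<le> card (V - X)"
      unfolding U_def using abc fin card_mono[of "V - X" "{a, b, c}"]
      by (auto simp: card_Diff_subset)
    ultimately show ?thesis by simp
  qed
  have U_ind: "\<not> A u v" if uv: "u \<in> U" "v \<in> U" for u v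
  proof
    assume "A u v"
    then have "cherry_free (V - X - {u, v})" using no_more uv unfolding U_def by blast
    moreover have "a \<in> V - X - {u, v}" "b \<in> V - X - {u, v}" "c \<in> V - X - {u, v}"
      using abc uv unfolding U_def by auto
    ultimately have "A a b \<or> A a c"
      using abc(4) unfolding cherry_free_def by blast
    then show False using abc by blast
  qed
  have evU: "even (card U)" using cU odd perfectly_matched_even[OF pX] by simp
  have U_eq: "V - X = {a, b, c} \<union> U" unfolding U_def using abc by auto
  have finU: "finite U" unfolding U_def using fin by simp
  have ab_edge: "\<exists>u\<in>V - X. \<exists>v\<in>V - X. A u v"
  proof (rule edge)
    have "V - (V - X) = X" using XV by auto
    then show "perfectly_matched (V - (V - X))" using pX by simp
    show "3 \<le> card (V - X)" using cU fin XV finX by (simp add: card_Diff_subset)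
  qed auto
  \<comment> \<open>Otherwise the cherry itself is the uncovered triple and spans at most one
    edge.\<close>
  have "card U \<noteq> 0"
  proof
    assume "card U = 0"
    then have "U = {}" using finU by simp
    then have "V = X \<union> {a, b, c}" using U_eq XV by blast
    then have "path3 a b c"
      by (rule lockedD[OF lo pX]) (use abc in auto)
    then show False using abc unfolding path3_def by blast
  qed
  \<comment> \<open>An edge outside \<open>X\<close> has at most one end in the independent set
    \<open>U\<close>. After matching it, three vertices of \<open>U\<close> would still form a
    cherry, against the maximality of \<open>X\<close>.\<close>
  moreover have "\<not> 4 \<le> card U"
  proof
    assume U4: "4 \<le> card U"
    obtain u v where uv: "u \<in> V - X" "v \<in> V - X" "A u v" using ab_edge by blast
    then have "u \<notin> U \<or> v \<notin> U" using U_ind by blast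
    then have "card (U \<inter> {u, v}) \<le> 1"
      using card_mono[of "{u}" "U \<inter> {u, v}"] card_mono[of "{v}" "U \<inter> {u, v}"] by auto
    then have "3 \<le> card (U - {u, v})"
      using U4 card_Diff_subset_Int[of U "{u, v}"] by simp
    then obtain Q where "Q \<subseteq> U - {u, v}" "card Q = 3" by (metis obtain_subset_with_card_n)
    then obtain p q r where pqr: "{p, q, r} \<subseteq> U - {u, v}" "distinct [p, q, r]"
      by (auto simp: card_3_iff)
    have "p \<in> V - X - {u, v}" "q \<in> V - X - {u, v}" "r \<in> V - X - {u, v}"
      using pqr(1) unfolding U_def by auto
    then have "A p q \<or> A p r"
      using no_more[OF uv] pqr(2) unfolding cherry_free_def by blast
    then show False using U_ind pqr(1) by blast
  qed
  ultimately have "card U = 2" using evU by (cases "card U = 1 \<or> card U = 3") auto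
  then obtain d e where de: "U = {d, e}" "d \<noteq> e" by (auto simp: card_2_iff)
  have W: "V - X = {a, b, c, d, e}" using U_eq de by auto
  have dist: "distinct [a, b, c, d, e]" using abc de unfolding U_def by auto
  have V_eq: "V = {a, b, c, d, e} \<union> X" using W XV by blast
  have lo5: "locked {a, b, c, d, e}"
    using locked_subset[of "V - X" X] lo pX V_eq W by auto
  have nde: "\<not> A d e" using U_ind de by blast
  consider "unbalanced_join {d, e} {a, b, c}" | "five_cycle a d b c e" | "five_cycle a d c b e"
    using locked_5[OF lo5 dist abc(5,6) nde] ab_edge unfolding W by blast
  \<comment> \<open>Seven vertices guarantee an edge outside the five, which rules out the
    5-cycle.\<close>
  moreover have X_ne: "X \<noteq> {}" using cU \<open>card U = 2\<close> c7 by auto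
  ultimately show ?thesis
  proof cases
    case 1
    have "\<not> cherry_free {a, b, c}" unfolding cherry_free_def using abc by blast
    moreover have "{d, e} \<union> {a, b, c} \<union> X = V" using V_eq by auto
    moreover have "({d, e} \<union> {a, b, c}) \<inter> X = {}" using W by blast
    moreover have "2 \<le> card {d, e}" using de by simp
    ultimately show ?thesis
      using unbalanced_join_extend_all[OF pX _ _ 1] lo by simp
  next
    case 2
    moreover have "V = {a, d, b, c, e} \<union> X" using V_eq by auto
    ultimately show ?thesis
      using five_cycle_matched[OF _ pX X_ne, of a d b c e] lo W by blast
  next
    case 3
    moreover have "V = {a, d, c, b, e} \<union> X" using V_eq by auto
    ultimately show ?thesis
      using five_cycle_matched[OF _ pX X_ne, of a d c b e] lo W by blast
  qed
qed

end

section \<open>Edge-stable equimatchable graphs\<close>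

lemma simple_graphD:
  assumes "simple_graph V E"
  shows "finite V" "e \<in> E \<Longrightarrow> card e = 2" "e \<in> E \<Longrightarrow> e \<subseteq> V" "e \<in> E \<Longrightarrow> e \<noteq> {}" "\<Union>E \<subseteq> V" "finite E"
proof -
  show fin: "finite V" using assms unfolding simple_graph_def by blast
  have *: "\<And>e. e \<in> E \<Longrightarrow> \<exists>u v. u \<noteq> v \<and> u \<in> V \<and> v \<in> V \<and> e = {u, v}"
    using assms unfolding simple_graph_def by blast
  show "e \<in> E \<Longrightarrow> card e = 2" using *[of e] by auto
  show "e \<in> E \<Longrightarrow> e \<subseteq> V" "e \<in> E \<Longrightarrow> e \<noteq> {}" using *[of e] by auto
  show U: "\<Union>E \<subseteq> V" using * by blast
  show "finite E" using U fin by (meson finite_UnionD finite_subset)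
qed

lemma matching_empty: "matching E {}"
  unfolding matching_def by simp

lemma matching_mono: "matching E M \<Longrightarrow> E \<subseteq> F \<Longrightarrow> matching F M"
  unfolding matching_def by blast

lemma matching_disjoint: "matching E M \<Longrightarrow> e \<in> M \<Longrightarrow> f \<in> M \<Longrightarrow> e \<noteq> f \<Longrightarrow> e \<inter> f = {}"
  unfolding matching_def by simp

lemma matching_insert:
  assumes "matching E M" "e \<in> E" "e \<inter> \<Union>M = {}"
  shows "matching E (insert e M)"
  using assms unfolding matching_def by blast

lemma card_Union_matching_Int:
  assumes G: "simple_graph V E" and M: "matching E M"
  shows "card (\<Union>M \<inter> U) = (\<Sum>e\<in>M. card (e \<inter> U))"
proof -
  have "finite M" using M G simple_graphD(6) finite_subset unfolding matching_def by metis
  have "\<And>e. e \<in> M \<Longrightarrow> finite e"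
    using M G simple_graphD(1,3) finite_subset unfolding matching_def by (metis subsetD)
  then have "card (\<Union>e\<in>M. e \<inter> U) = (\<Sum>e\<in>M. card (e \<inter> U))"
    using M \<open>finite M\<close> unfolding matching_def by (intro card_UN_disjoint) blast+
  moreover have "(\<Union>e\<in>M. e \<inter> U) = \<Union>M \<inter> U" by blast
  ultimately show ?thesis by simp
qed

lemma card_Union_matching:
  assumes G: "simple_graph V E" and M: "matching E M"
  shows "card (\<Union>M) = 2 * card M"
proof -
  have "card (\<Union>M \<inter> V) = (\<Sum>e\<in>M. 2)"
    unfolding card_Union_matching_Int[OF G M]
  proof (rule sum.cong)
    fix e assume "e \<in> M"
    then have "e \<in> E" using M unfolding matching_def by blast
    then show "card (e \<inter> V) = 2" using simple_graphD(2,3)[OF G] by (simp add: Int_absorb2)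
  qed simp
  moreover have "\<Union>M \<inter> V = \<Union>M"
    using M simple_graphD(5)[OF G] unfolding matching_def by blast
  ultimately show ?thesis by simp
qed

text \<open>Any proper extension would contain an edge lying in the uncovered set. The edge set
  \<open>E'\<close> may be smaller than \<open>E\<close>, so that the criterion also serves after an
  edge deletion.\<close>

lemma maximal_matchingI:
  assumes G: "simple_graph V E" and EF: "E' \<subseteq> E" and M: "matching E' M"
    and free: "\<And>e. e \<in> E' \<Longrightarrow> \<not> e \<subseteq> V - \<Union>M"
  shows "maximal_matching E' M"
  unfolding maximal_matching_def
proof (intro conjI allI impI M)
  fix M' assume M': "matching E' M' \<and> M \<subseteq> M'"
  show "M' = M"
  proof (rule ccontr)
    assume "M' \<noteq> M"
    then obtain f where f: "f \<in> M'" "f \<notin> M" using M' by blast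
    have disj: "f \<inter> e = {}" if e: "e \<in> M" for e
    proof -
      have "e \<in> M'" "f \<noteq> e" using M' f e by auto
      then show ?thesis using M' f(1) unfolding matching_def by simp
    qed
    have "f \<in> E'" using f M' unfolding matching_def by auto
    moreover have "f \<subseteq> V" using simple_graphD(3)[OF G] EF \<open>f \<in> E'\<close> by auto
    then have "f \<subseteq> V - \<Union>M" using disj by auto
    ultimately show False using free by simp
  qed
qed

lemma maximal_matching_free:
  assumes G: "simple_graph V E" and EF: "E' \<subseteq> E" and M: "maximal_matching E' M" and e: "e \<in> E'"
  shows "\<not> e \<subseteq> V - \<Union>M"
proof
  assume s: "e \<subseteq> V - \<Union>M"
  have "matching E' M" using M unfolding maximal_matching_def by blast
  then have "matching E' (insert e M)" using e s by (intro matching_insert) auto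
  then have "e \<in> M" using M unfolding maximal_matching_def by blast
  then have "e = {}" using s by blast
  then show False using simple_graphD(4)[OF G] e EF by blast
qed

section \<open>Uncovered sets and edge-stability\<close>

lemma factor_critical_odd:
  assumes G: "simple_graph V E" and fc: "factor_critical V E" and ne: "V \<noteq> {}"
  shows "odd (card V)"
proof -
  obtain v where v: "v \<in> V" using ne by blast
  then obtain M where M: "matching {e \<in> E. v \<notin> e} M" "\<Union>M = V - {v}"
    using fc unfolding factor_critical_def by blast
  have "matching E M" by (rule matching_mono[OF M(1)]) auto
  then have "card (V - {v}) = 2 * card M" using card_Union_matching[OF G] M(2) by metis
  moreover have "card V = Suc (card (V - {v}))"
    using card_Suc_Diff1[OF simple_graphD(1)[OF G] v] by simp
  ultimately show ?thesis by simp
qed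

text \<open>If \<open>e\<close> were the only possible edge among the uncovered vertices, deleting
  it would make \<open>M\<close> maximal beside a matching that misses a single vertex. Choosing
  \<open>e\<close> freely allows a second edge to be demanded once a first is known.\<close>

lemma ESE_uncovered_edges:
  assumes G: "simple_graph V E" and fc: "factor_critical V E" and ese: "ESE E"
    and M: "matching E M" and U: "3 \<le> card (V - \<Union>M)"
  shows "\<exists>f\<in>E. f \<subseteq> V - \<Union>M \<and> f \<noteq> e"
proof (rule ccontr)
  assume no: "\<not> ?thesis"
  note G' = simple_graphD[OF G]
  define I where "I = V - \<Union>M"
  define E' where "E' = (if e \<in> E \<and> e \<subseteq> I then E - {e} else E)"
  have sub: "E' \<subseteq> E" unfolding E'_def by auto
  have eq: "equimatchable E'" using ese unfolding ESE_def E'_def by auto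
  have MV: "\<Union>M \<subseteq> V" using M G'(5) unfolding matching_def by blast
  have "e \<notin> M \<or> E' = E"
    unfolding E'_def I_def using G'(4)[of e] by (auto simp: subset_iff)
  then have ME': "matching E' M" using M unfolding matching_def E'_def by auto
  have max: "maximal_matching E' M"
  proof (rule maximal_matchingI[OF G sub ME'])
    fix f assume f: "f \<in> E'"
    show "\<not> f \<subseteq> V - \<Union>M"
    proof
      assume fI: "f \<subseteq> V - \<Union>M"
      then have "f = e" using no f sub by blast
      then show False using f fI sub unfolding E'_def I_def by (simp split: if_splits)
    qed
  qed
  \<comment> \<open>When \<open>e\<close> is deleted, \<open>v\<close> is one of its ends: a
    matching that avoids \<open>v\<close> cannot use \<open>e\<close>.\<close>
  have "\<exists>v\<in>V. {f \<in> E. v \<notin> f} \<subseteq> E'"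
  proof (cases "e \<in> E \<and> e \<subseteq> I")
    case True
    then obtain v where "v \<in> e" using G'(4) by blast
    then show ?thesis using G'(3) True unfolding E'_def by (intro bexI[of _ v]) auto
  next
    case False
    have "V \<noteq> {}" using U by auto
    then show ?thesis using False unfolding E'_def by auto
  qed
  then obtain v where v: "v \<in> V" "{f \<in> E. v \<notin> f} \<subseteq> E'" by blast
  obtain N where N: "matching {f \<in> E. v \<notin> f} N" "\<Union>N = V - {v}"
    using fc v(1) unfolding factor_critical_def by blast
  have N': "matching E' N" by (rule matching_mono[OF N(1) v(2)])
  have "V - \<Union>N = {v}" using N(2) v by blast
  then have maxN: "maximal_matching E' N"
  proof (intro maximal_matchingI[OF G sub N'])
    fix f assume "f \<in> E'"
    then have "card f = 2" using G'(2) sub by auto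
    then show "\<not> f \<subseteq> V - \<Union>N"
      using card_mono[of "{v}" f] unfolding \<open>V - \<Union>N = {v}\<close> by auto
  qed
  have "card M = card N" using eq max maxN unfolding equimatchable_def by blast
  then have "card (\<Union>M) = card (\<Union>N)"
    using card_Union_matching[OF G] matching_mono[OF N' sub] M by simp
  moreover have "card (\<Union>N) = card V - 1" using N(2) v G'(1) by simp
  moreover have "card (V - \<Union>M) = card V - card (\<Union>M)" "card (\<Union>M) \<le> card V"
    using MV G'(1) by (auto simp: card_Diff_subset card_mono finite_subset)
  ultimately show False using U by linarith
qed

text \<open>A maximal matching of \<open>E\<close> or of \<open>E - {e}\<close> leaves at most the
  edge \<open>e\<close> uncovered, hence at most two vertices. As \<open>card V\<close> is odd,
  exactly one is left, and all sizes agree.\<close>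

lemma ESE_I:
  assumes G: "simple_graph V E" and odd: "odd (card V)"
    and small: "\<And>M e. matching E M \<Longrightarrow> \<forall>f\<in>E. f \<subseteq> V - \<Union>M \<longrightarrow> f = e \<Longrightarrow> card (V - \<Union>M) \<le> 2"
  shows "ESE E"
proof -
  note G' = simple_graphD[OF G]
  have size: "2 * card M + 1 = card V" if sub: "E - {e} \<subseteq> E'" "E' \<subseteq> E" and max: "maximal_matching E' M" for e E' M
  proof -
    have M: "matching E M"
      using max sub(2) matching_mono unfolding maximal_matching_def by blast
    have "card (V - \<Union>M) \<le> 2"
      by (rule small[OF M, of e]) (use maximal_matching_free[OF G sub(2) max] sub(1) in blast)
    moreover have "\<Union>M \<subseteq> V" using M G'(5) unfolding matching_def by blast
    then have "card (V - \<Union>M) + card (\<Union>M) = card V"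
      using G'(1) by (metis card_Diff_subset card_mono finite_subset le_add_diff_inverse2)
    moreover have "card (\<Union>M) = 2 * card M" by (rule card_Union_matching[OF G M])
    ultimately show ?thesis using odd by presburger
  qed
  have "equimatchable E'" if "E - {e} \<subseteq> E'" "E' \<subseteq> E" for e E'
    unfolding equimatchable_def using size[OF that] by (metis add_right_cancel mult_cancel1 zero_neq_numeral)
  then show ?thesis unfolding ESE_def by blast
qed

section \<open>Edge sets and adjacency relations\<close>

lemma complete_edges_iff: "{a, b} \<in> complete_edges W \<longleftrightarrow> a \<in> W \<and> b \<in> W \<and> a \<noteq> b"
proof
  show "{a, b} \<in> complete_edges W \<Longrightarrow> a \<in> W \<and> b \<in> W \<and> a \<noteq> b"
    unfolding complete_edges_def by (auto simp: doubleton_eq_iff)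
qed (unfold complete_edges_def, blast)

lemma simple_graph_edgeE:
  assumes "simple_graph V E" "e \<in> E"
  obtains u v where "u \<in> V" "v \<in> V" "u \<noteq> v" "e = {u, v}"
  using assms unfolding simple_graph_def by blast

lemma adjacency_simple_graph:
  assumes "simple_graph V E"
  shows "adjacency (\<lambda>x y. {x, y} \<in> E)"
proof
  show "{y, x} \<in> E" if "{x, y} \<in> E" for x y
    using that by (simp add: insert_commute)
  show "{x, x} \<notin> E" for x
    using simple_graphD(2)[OF assms, of "{x, x}"] by auto
qed

lemma perfectly_matched_matching:
  assumes G: "simple_graph V E" and X: "adjacency.perfectly_matched (\<lambda>x y. {x, y} \<in> E) X"
  shows "\<exists>M. matching E M \<and> \<Union>M = X"
proof -
  interpret adjacency "\<lambda>x y. {x, y} \<in> E" by (rule adjacency_simple_graph[OF G])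
  show ?thesis using X
  proof (induction rule: perfectly_matched.induct)
    case empty
    then show ?case using matching_empty by (intro exI[of _ "{}"]) auto
  next
    case (step X u v)
    then obtain M where M: "matching E M" "\<Union>M = X" by blast
    have "matching E (insert {u, v} M)"
      by (rule matching_insert[OF M(1) step(2)]) (use M(2) step in auto)
    moreover have "\<Union>(insert {u, v} M) = insert u (insert v X)" using M(2) by auto
    ultimately show ?case by blast
  qed
qed

lemma factor_critical_cover:
  assumes "factor_critical V E" "v \<in> V"
  shows "\<exists>M. matching E M \<and> \<Union>M = V - {v}"
proof -
  obtain M where "matching {e \<in> E. v \<notin> e} M" "\<Union>M = V - {v}"
    using assms unfolding factor_critical_def by blast
  then show ?thesis using matching_mono[of "{e \<in> E. v \<notin> e}" M E] by auto
qed

section \<open>Complete graphs with a matching removed\<close>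

lemma cherry_free_ESE:
  assumes G: "simple_graph V E" and odd: "odd (card V)"
    and cf: "\<And>p q r. p \<in> V \<Longrightarrow> q \<in> V \<Longrightarrow> r \<in> V \<Longrightarrow> distinct [p, q, r] \<Longrightarrow> {p, q} \<in> E \<or> {p, r} \<in> E"
  shows "ESE E"
proof (rule ESE_I[OF G odd], rule ccontr)
  fix M e assume e: "\<forall>f\<in>E. f \<subseteq> V - \<Union>M \<longrightarrow> f = e" and "\<not> card (V - \<Union>M) \<le> 2"
  then have "3 \<le> card (V - \<Union>M)" by simp
  then obtain Q where "Q \<subseteq> V - \<Union>M" "card Q = 3" by (metis obtain_subset_with_card_n)
  then obtain u v w where uvw: "u \<in> V - \<Union>M" "v \<in> V - \<Union>M" "w \<in> V - \<Union>M" "distinct [u, v, w]"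
    by (auto simp: card_3_iff)
  have only: "{p, q} \<in> E \<Longrightarrow> {p, q} = e" if "p \<in> {u, v, w}" "q \<in> {u, v, w}" for p q
  proof -
    have "{p, q} \<subseteq> V - \<Union>M" using that uvw(1-3) by blast
    then show "{p, q} \<in> E \<Longrightarrow> {p, q} = e" using e by blast
  qed
  \<comment> \<open>One disjunction per vertex: a single edge misses one of the three vertices, so
    it cannot satisfy them all.\<close>
  have "{u, v} \<in> E \<or> {u, w} \<in> E" "{v, u} \<in> E \<or> {v, w} \<in> E" "{w, u} \<in> E \<or> {w, v} \<in> E"
    using cf[of u v w] cf[of v u w] cf[of w u v] uvw by auto
  then have "{u, v} = e \<or> {u, w} = e" "{v, u} = e \<or> {v, w} = e" "{w, u} = e \<or> {w, v} = e"
    using only by blast+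
  then show False using uvw(4) by (auto simp: doubleton_eq_iff)
qed

text \<open>Two non-edges at \<open>p\<close> would be sent to two different edges of the removed
  matching that meet in \<open>f p\<close>.\<close>

lemma in_G1_cherry_free:
  assumes "in_G1 V E" "p \<in> V" "q \<in> V" "r \<in> V" "distinct [p, q, r]"
  shows "{p, q} \<in> E \<or> {p, r} \<in> E"
proof (rule ccontr)
  assume non: "\<not> ?thesis"
  obtain n M f where M: "matching (complete_edges {0..<n::nat}) M" and f: "bij_betw f V {0..<n}"
    and adj: "\<And>u v. u \<in> V \<Longrightarrow> v \<in> V \<Longrightarrow> {u, v} \<in> E \<longleftrightarrow> {f u, f v} \<in> complete_edges {0..<n} - M"
    using assms(1) unfolding in_G1_def graph_iso_def by blast
  have "f p \<noteq> f q" "f p \<noteq> f r" "f q \<noteq> f r"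
    using f assms(2-5) unfolding bij_betw_def inj_on_def by auto
  moreover have "f p \<in> {0..<n}" "f q \<in> {0..<n}" "f r \<in> {0..<n}"
    using f assms(2-4) unfolding bij_betw_def by auto
  ultimately have "{f p, f q} \<in> M" "{f p, f r} \<in> M" "{f p, f q} \<noteq> {f p, f r}"
    using non adj assms(2-4) unfolding complete_edges_def by (auto simp: doubleton_eq_iff)
  then have "{f p, f q} \<inter> {f p, f r} = {}" by (rule matching_disjoint[OF M])
  then show False by blast
qed

lemma cherry_free_in_G1:
  assumes G: "simple_graph V E" and odd: "odd (card V)" and c7: "7 \<le> card V"
    and cf: "\<And>p q r. p \<in> V \<Longrightarrow> q \<in> V \<Longrightarrow> r \<in> V \<Longrightarrow> distinct [p, q, r] \<Longrightarrow> {p, q} \<in> E \<or> {p, r} \<in> E"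
    and nc: "E \<noteq> complete_edges V"
  shows "in_G1 V E"
proof -
  obtain k where k: "card V = 2 * k + 1" using odd by (elim oddE)
  let ?n = "2 * k + 1"
  obtain f where f: "bij_betw f V {0..<?n}"
    using ex_bij_betw_finite_nat[OF simple_graphD(1)[OF G]] k by metis
  have inj: "f u = f v \<longleftrightarrow> u = v" if "u \<in> V" "v \<in> V" for u v
    using f that unfolding bij_betw_def inj_on_def by blast
  have range: "f u \<in> {0..<?n}" if "u \<in> V" for u
    using f that unfolding bij_betw_def by blast
  have edge_neq: "u \<noteq> v" if "{u, v} \<in> E" for u v
    using simple_graphD(2)[OF G that] by auto
  \<comment> \<open>The images of the non-edges; they are pairwise disjoint because two meeting ones
    would come from a cherry.\<close>
  define M where "M = {{f u, f v} | u v. u \<in> V \<and> v \<in> V \<and> u \<noteq> v \<and> {u, v} \<notin> E}"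
  have in_M: "{f u, f v} \<in> M \<longleftrightarrow> u \<noteq> v \<and> {u, v} \<notin> E" if "u \<in> V" "v \<in> V" for u v
    using that unfolding M_def by (auto simp: doubleton_eq_iff inj insert_commute)
  have "matching (complete_edges {0..<?n}) M"
    unfolding matching_def
  proof (intro conjI ballI impI)
    show "M \<subseteq> complete_edges {0..<?n}"
      unfolding M_def complete_edges_def using range inj by blast
    fix e1 e2 assume e: "e1 \<in> M" "e2 \<in> M" "e1 \<noteq> e2"
    show "e1 \<inter> e2 = {}"
    proof (rule ccontr)
      assume "e1 \<inter> e2 \<noteq> {}"
      then obtain z where z: "z \<in> e1" "z \<in> e2" by blast
      have rep: "\<exists>u v. u \<in> V \<and> v \<in> V \<and> u \<noteq> v \<and> {u, v} \<notin> E \<and> z = f u \<and> e = {f u, f v}"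
        if ez: "e \<in> M" "z \<in> e" for e
      proof -
        obtain u v where uv: "u \<in> V" "v \<in> V" "u \<noteq> v" "{u, v} \<notin> E" "e = {f u, f v}"
          using ez(1) unfolding M_def by blast
        then have "{v, u} \<notin> E" "e = {f v, f u}" by (simp_all add: insert_commute)
        then show ?thesis using uv ez(2) by (cases "z = f u") auto
      qed
      obtain u v where u: "u \<in> V" "v \<in> V" "u \<noteq> v" "{u, v} \<notin> E" "z = f u" "e1 = {f u, f v}"
        using rep[OF e(1) z(1)] by blast
      obtain u' w where w: "u' \<in> V" "w \<in> V" "u' \<noteq> w" "{u', w} \<notin> E" "z = f u'" "e2 = {f u', f w}"
        using rep[OF e(2) z(2)] by blast
      have "u' = u" using inj[OF w(1) u(1)] u(5) w(5) by simp
      then have "v \<noteq> w" using e(3) u(6) w(6) by auto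
      then show False using cf[OF u(1,2) w(2)] u w \<open>u' = u\<close> by auto
    qed
  qed
  moreover have "M \<noteq> {}"
  proof -
    have "E \<subseteq> complete_edges V"
      using simple_graph_edgeE[OF G] unfolding complete_edges_def by blast
    then obtain u v where "u \<in> V" "v \<in> V" "u \<noteq> v" "{u, v} \<notin> E"
      using nc unfolding complete_edges_def by blast
    then show ?thesis using in_M by blast
  qed
  moreover have "{u, v} \<in> E \<longleftrightarrow> {f u, f v} \<in> complete_edges {0..<?n} - M" if "u \<in> V" "v \<in> V" for u v
  proof -
    have "{f u, f v} \<in> complete_edges {0..<?n} \<longleftrightarrow> u \<noteq> v"
      using range inj that by (simp add: complete_edges_iff)
    then show ?thesis using in_M[OF that] edge_neq by blast
  qed
  then have "graph_iso V E {0..<?n} (complete_edges {0..<?n} - M)"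
    unfolding graph_iso_def using f by blast
  moreover have "3 \<le> k" using c7 k by simp
  ultimately show ?thesis unfolding in_G1_def by blast
qed

section \<open>The family of joins\<close>

lemma nu_eq_1I:
  assumes "finite E" "E \<noteq> {}" "\<And>M. matching E M \<Longrightarrow> card M \<le> 1"
  shows "nu E = 1"
proof -
  have fin: "finite {M. matching E M}"
    by (rule finite_subset[of _ "Pow E"]) (use assms(1) in \<open>auto simp: matching_def\<close>)
  obtain e where "e \<in> E" using assms(2) by blast
  then have "matching E {e}" unfolding matching_def by simp
  then have "1 \<in> card ` {M. matching E M}" by (intro image_eqI[of _ _ "{e}"]) auto
  then show ?thesis unfolding nu_def using fin assms(3) by (intro Max_eqI) auto
qed

lemma card_le_nu:
  assumes "finite E" "matching E M"
  shows "card M \<le> nu E"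
proof -
  have "finite {M. matching E M}"
    by (rule finite_subset[of _ "Pow E"]) (use assms(1) in \<open>auto simp: matching_def\<close>)
  then show ?thesis unfolding nu_def using assms(2) by (intro Max_ge) auto
qed

text \<open>Since \<open>S\<close> is independent, an edge of \<open>M\<close> either has one end on
  each side or lies inside \<open>V - S\<close>, where it contributes two.\<close>

lemma matching_balance:
  assumes G: "simple_graph V E" and S: "S \<subseteq> V" "\<And>u v. u \<in> S \<Longrightarrow> v \<in> S \<Longrightarrow> {u, v} \<notin> E"
    and M: "matching E M"
  shows "card (\<Union>M \<inter> (V - S)) = card (\<Union>M \<inter> S) + 2 * card {e \<in> M. e \<subseteq> V - S}"
proof -
  have finM: "finite M"
    using M simple_graphD(6)[OF G] finite_subset unfolding matching_def by metis
  have "card (e \<inter> (V - S)) = card (e \<inter> S) + 2 * (if e \<subseteq> V - S then 1 else 0)" if e: "e \<in> M" for e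
  proof -
    have "e \<in> E" using e M unfolding matching_def by blast
    then obtain u v where uv: "u \<in> V" "v \<in> V" "u \<noteq> v" "e = {u, v}" "{u, v} \<in> E"
      using simple_graph_edgeE[OF G] by metis
    have "\<not> (u \<in> S \<and> v \<in> S)" using S(2) uv(5) by blast
    then show ?thesis using uv(1-4) by (cases "u \<in> S"; cases "v \<in> S") auto
  qed
  then have "(\<Sum>e\<in>M. card (e \<inter> (V - S)))
      = (\<Sum>e\<in>M. card (e \<inter> S)) + 2 * (\<Sum>e\<in>M. if e \<subseteq> V - S then 1 else 0)"
    by (simp add: sum.distrib sum_distrib_left)
  also have "(\<Sum>e\<in>M. if e \<subseteq> V - S then 1 else 0) = card {e \<in> M. e \<subseteq> V - S}"
    using finM by (simp add: sum.If_cases Int_def)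
  finally show ?thesis unfolding card_Union_matching_Int[OF G M] .
qed

lemma matching_induced:
  assumes "matching E M"
  shows "matching (induced_edges E U) {e \<in> M. e \<subseteq> U}"
  using assms unfolding matching_def induced_edges_def by auto

lemma in_G2_ESE:
  assumes G: "simple_graph V E" and fc: "factor_critical V E" and ne: "V \<noteq> {}" and G2: "in_G2 V E"
  shows "ESE E"
proof -
  obtain S where S: "S \<subseteq> V" "3 \<le> card S" "\<And>u v. u \<in> S \<Longrightarrow> v \<in> S \<Longrightarrow> {u, v} \<notin> E"
      "\<And>u v. u \<in> S \<Longrightarrow> v \<in> V - S \<Longrightarrow> {u, v} \<in> E" and nu: "nu (induced_edges E (V - S)) = 1"
    using G2 unfolding in_G2_def by blast
  define T where "T = V - S"
  note G' = simple_graphD[OF G]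
  have fin: "finite S" "finite T" unfolding T_def using G'(1) S(1) finite_subset by auto
  have fin_ind: "finite (induced_edges E T)" using G'(6) unfolding induced_edges_def by simp
  have bal: "\<exists>j\<le>1. card (\<Union>M \<inter> T) = card (\<Union>M \<inter> S) + 2 * j" if M: "matching E M" for M
    using matching_balance[OF G S(1,3) M] card_le_nu[OF fin_ind matching_induced[OF M]] nu
    unfolding T_def by auto
  note cover = factor_critical_cover[OF fc]
  have "T \<noteq> {}"
  proof
    assume "T = {}"
    then have "induced_edges E T = {}"
      using G'(4) unfolding induced_edges_def by auto
    then have "{M. matching (induced_edges E T) M} = {{}}" unfolding matching_def by auto
    then show False using nu unfolding T_def nu_def by simp
  qed
  then obtain t where t: "t \<in> V" "t \<in> T" "t \<notin> S" unfolding T_def by blast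
  obtain Mt where "matching E Mt" "\<Union>Mt = V - {t}" using cover t by blast
  moreover have "(V - {t}) \<inter> T = T - {t}" "(V - {t}) \<inter> S = S"
    using t S(1) unfolding T_def by auto
  ultimately have "\<exists>j\<le>1. card (T - {t}) = card S + 2 * j" using bal by metis
  \<comment> \<open>The matching missing \<open>t\<close> bounds \<open>card T\<close> from below;
    the one missing \<open>s\<close> bounds it from above, as at most one edge lies inside
    \<open>T\<close>.\<close>
  then have le: "card S + 1 \<le> card T" using card_Suc_Diff1[OF fin(2) t(2)] by auto
  have "S \<noteq> {}" using S(2) by auto
  then obtain s where s: "s \<in> V" "s \<in> S" "s \<notin> T" using S(1) unfolding T_def by blast
  obtain Ms where "matching E Ms" "\<Union>Ms = V - {s}" using cover s by blast
  moreover have "(V - {s}) \<inter> T = T" "(V - {s}) \<inter> S = S - {s}"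
    using s S(1) unfolding T_def by auto
  ultimately have "\<exists>j\<le>1. card T = card (S - {s}) + 2 * j" using bal by metis
  then have "card T \<le> card S + 1" using card_Suc_Diff1[OF fin(1) s(2)] by auto
  with le have cT: "card T = card S + 1" by simp
  show ?thesis
  proof (rule ESE_I[OF G factor_critical_odd[OF G fc ne]], rule ccontr)
    fix M e assume M: "matching E M" and e: "\<forall>f\<in>E. f \<subseteq> V - \<Union>M \<longrightarrow> f = e"
      and big: "\<not> card (V - \<Union>M) \<le> 2"
    define P where "P = S - \<Union>M"
    define Q where "Q = T - \<Union>M"
    have finPQ: "finite P" "finite Q" unfolding P_def Q_def using fin by auto
    have "card S = card P + card (\<Union>M \<inter> S)" "card T = card Q + card (\<Union>M \<inter> T)"
      unfolding P_def Q_def using card_Int_Diff[OF fin(1), of "\<Union>M"] card_Int_Diff[OF fin(2), of "\<Union>M"]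
      by (simp_all add: Int_commute)
    moreover have "V - \<Union>M = P \<union> Q" "P \<inter> Q = {}" unfolding P_def Q_def T_def using S(1) by auto
    then have "3 \<le> card P + card Q" using big card_Un_disjoint[OF finPQ] by simp
    moreover obtain j where "j \<le> 1" "card (\<Union>M \<inter> T) = card (\<Union>M \<inter> S) + 2 * j" using bal[OF M] by blast
    \<comment> \<open>The sizes of \<open>P\<close> and \<open>Q\<close> differ by exactly one and
      sum to at least three, so the join gives two distinct edges between them.\<close>
    ultimately have *: "1 \<le> card P \<and> 2 \<le> card Q \<or> 2 \<le> card P \<and> 1 \<le> card Q"
      using cT by (cases "j = 0") auto
    have only: "{u, v} = e" if "u \<in> P" "v \<in> Q" for u v
    proof -
      have "{u, v} \<in> E" using S(4) that unfolding P_def Q_def T_def by blast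
      moreover have "{u, v} \<subseteq> V - \<Union>M"
        using S(1) that unfolding P_def Q_def T_def by blast
      ultimately show ?thesis using e by blast
    qed
    have two: "\<exists>u v. u \<in> X \<and> v \<in> X \<and> u \<noteq> v" if "2 \<le> card X" for X :: "'a set"
      using that by (metis card_2_iff' obtain_subset_with_card_n subsetD)
    have one: "\<exists>u. u \<in> X" if "1 \<le> card X" for X :: "'a set"
      using that by (cases "X = {}") auto
    have PQ: "u \<noteq> v" if "u \<in> P" "v \<in> Q" for u v using that \<open>P \<inter> Q = {}\<close> by blast
    from * show False
    proof
      assume "1 \<le> card P \<and> 2 \<le> card Q"
      then obtain u v w where "u \<in> P" "v \<in> Q" "w \<in> Q" "v \<noteq> w" using one two by metis
      then have "{u, v} = {u, w}" "u \<noteq> v" "u \<noteq> w" using only PQ by auto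
      then show False using \<open>v \<noteq> w\<close> by (auto simp: doubleton_eq_iff)
    next
      assume "2 \<le> card P \<and> 1 \<le> card Q"
      then obtain u v w where "u \<in> P" "w \<in> P" "u \<noteq> w" "v \<in> Q" using one two by metis
      then have "{u, v} = {w, v}" "u \<noteq> v" "w \<noteq> v" using only PQ by auto
      then show False using \<open>u \<noteq> w\<close> by (auto simp: doubleton_eq_iff)
    qed
  qed
qed

lemma ESE_in_G2:
  assumes G: "simple_graph V E" and fc: "factor_critical V E" and c7: "7 \<le> card V" and ese: "ESE E"
    and pqr: "p \<in> V" "q \<in> V" "r \<in> V" "distinct [p, q, r]" "{p, q} \<notin> E" "{p, r} \<notin> E"
  shows "in_G2 V E"
proof -
  interpret adjacency "\<lambda>x y. {x, y} \<in> E" by (rule adjacency_simple_graph[OF G])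
  note G' = simple_graphD[OF G]
  have ne: "V \<noteq> {}" using pqr by blast
  have uncovered: "\<exists>u v. u \<in> I \<and> v \<in> I \<and> {u, v} \<in> E \<and> {u, v} \<noteq> e"
    if I: "I \<subseteq> V" "3 \<le> card I" "perfectly_matched (V - I)" for I e
  proof -
    obtain M where M: "matching E M" "\<Union>M = V - I"
      using perfectly_matched_matching[OF G I(3)] by blast
    have VM: "V - \<Union>M = I" using M(2) I(1) by blast
    then obtain f where f: "f \<in> E" "f \<subseteq> I" "f \<noteq> e"
      using ESE_uncovered_edges[OF G fc ese M(1), of e] I(2) by auto
    obtain u v where "f = {u, v}" using simple_graph_edgeE[OF G f(1)] by metis
    then show ?thesis using f by auto
  qed
  have "locked V"
    unfolding locked_def
  proof (intro ballI impI)
    fix u v w assume uvw: "u \<in> V" "v \<in> V" "w \<in> V" "distinct [u, v, w]"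
      and pm: "perfectly_matched (V - {u, v, w})"
    have I: "{u, v, w} \<subseteq> V" "3 \<le> card {u, v, w}" using uvw by auto
    obtain a b where ab: "a \<in> {u, v, w}" "b \<in> {u, v, w}" "{a, b} \<in> E"
      using uncovered[OF I pm] by blast
    \<comment> \<open>A second edge of the triple, obtained by excluding the first.\<close>
    obtain c d where cd: "c \<in> {u, v, w}" "d \<in> {u, v, w}" "{c, d} \<in> E" "{c, d} \<noteq> {a, b}"
      using uncovered[OF I pm, of "{a, b}"] by blast
    have E: "{x, y} \<in> {{u, v}, {u, w}, {v, w}}"
      if "x \<in> {u, v, w}" "y \<in> {u, v, w}" "{x, y} \<in> E" for x y
      using that irrefl by (auto simp: insert_commute)
    have two: "P \<in> E \<and> Q \<in> E \<or> P \<in> E \<and> R \<in> E \<or> Q \<in> E \<and> R \<in> E"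
      if "X \<in> {P, Q, R}" "Y \<in> {P, Q, R}" "X \<in> E" "Y \<in> E" "Y \<noteq> X" for P Q R X Y
      using that by auto
    show "path3 u v w"
      unfolding path3_def by (rule two[OF E[OF ab] E[OF cd(1-3)] ab(3) cd(3,4)])
  qed
  moreover have "\<not> cherry_free V" using pqr unfolding cherry_free_def by blast
  moreover have "\<exists>u\<in>I. \<exists>v\<in>I. {u, v} \<in> E" if "I \<subseteq> V" "3 \<le> card I" "perfectly_matched (V - I)" for I
    using uncovered[OF that] by blast
  ultimately obtain S T where j: "unbalanced_join S T" and ST: "S \<union> T = V"
    using locked_cases[OF G'(1) factor_critical_odd[OF G fc ne] c7] by blast
  note j' = j[unfolded unbalanced_join_def]
  have T: "T = V - S" using j' ST by blast
  have S: "S \<subseteq> V" "\<And>u v. u \<in> S \<Longrightarrow> v \<in> S \<Longrightarrow> {u, v} \<notin> E" using j' ST by auto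
  have "card V = card S + card T" using j' ST card_Un_disjoint by metis
  then have c3: "3 \<le> card S" using j' c7 by simp
  \<comment> \<open>Without an edge inside \<open>T\<close>, a matching missing a vertex of
    \<open>S\<close> would match all of \<open>T\<close> into fewer vertices of
    \<open>S\<close>.\<close>
  have "induced_edges E T \<noteq> {}"
  proof
    assume empty: "induced_edges E T = {}"
    obtain s where s: "s \<in> S" using c3 by fastforce
    then have "s \<in> V" using S(1) by blast
    then obtain M where M: "matching E M" "\<Union>M = V - {s}"
      using factor_critical_cover[OF fc, of s] by auto
    note M' = matching_balance[OF G S M(1)]
    have "{e \<in> M. e \<subseteq> V - S} = {}"
      using empty M(1) unfolding T matching_def induced_edges_def by auto
    then have "card {e \<in> M. e \<subseteq> V - S} = 0" by (simp only: card.empty)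
    moreover have "(V - {s}) \<inter> (V - S) = T" "(V - {s}) \<inter> S = S - {s}"
      using s S(1) unfolding T by auto
    ultimately have "card T = card (S - {s})" using M' unfolding M(2) T by simp
    then show False using j' card_Diff1_le[of S s] by simp
  qed
  moreover have "card M \<le> 1" if M: "matching (induced_edges E T) M" for M
  proof (rule ccontr)
    assume "\<not> card M \<le> 1"
    then have "2 \<le> card M" by simp
    then obtain e f where ef: "e \<in> M" "f \<in> M" "e \<noteq> f"
      by (metis card_2_iff' obtain_subset_with_card_n subsetD)
    then have "e \<inter> f = {}" by (rule matching_disjoint[OF M])
    moreover have sub: "e \<in> E" "f \<in> E" "e \<subseteq> T" "f \<subseteq> T"
      using ef M unfolding matching_def induced_edges_def by auto
    moreover obtain t1 t2 where "t1 \<noteq> t2" "e = {t1, t2}" using simple_graph_edgeE[OF G sub(1)] by metis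
    moreover obtain t3 t4 where "t3 \<noteq> t4" "f = {t3, t4}" using simple_graph_edgeE[OF G sub(2)] by metis
    ultimately show False
      using \<open>locked V\<close> ST by (intro join_nu[OF _ j, of t1 t2 t3 t4]) auto
  qed
  moreover have "finite (induced_edges E T)" using G'(6) unfolding induced_edges_def by simp
  ultimately have "nu (induced_edges E T) = 1" by (intro nu_eq_1I) auto
  then show ?thesis
    unfolding in_G2_def using S c3 j' T by (intro exI[of _ S]) auto
qed

theorem theorem3p6:
  fixes V :: "'a set" and E :: "'a set set"
  assumes "simple_graph V E" and "factor_critical V E" and "card V \<ge> 7"
  shows "ESE E \<longleftrightarrow>
           (E = complete_edges V \<and> odd (card V)) \<or> in_G1 V E \<or> in_G2 V E"
proof -
  note G = assms(1) and fc = assms(2)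
  have ne: "V \<noteq> {}" using assms(3) by auto
  have odd: "odd (card V)" by (rule factor_critical_odd[OF G fc ne])
  show ?thesis
  proof
    assume ese: "ESE E"
    \<comment> \<open>The split is on whether some vertex has two non-neighbours: if so,
      \<open>ESE_in_G2\<close> applies; if not, the graph is complete or in the first
      family.\<close>
    show "(E = complete_edges V \<and> odd (card V)) \<or> in_G1 V E \<or> in_G2 V E"
      using ESE_in_G2[OF G fc assms(3) ese] cherry_free_in_G1[OF G odd assms(3)] odd by blast
  next
    assume "(E = complete_edges V \<and> odd (card V)) \<or> in_G1 V E \<or> in_G2 V E"
    then show "ESE E"
    proof (elim disjE)
      assume "E = complete_edges V \<and> odd (card V)"
      then show ?thesis
        by (intro cherry_free_ESE[OF G odd]) (auto simp: complete_edges_def)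
    next
      assume "in_G1 V E"
      then show ?thesis by (rule cherry_free_ESE[OF G odd in_G1_cherry_free])
    next
      assume "in_G2 V E"
      then show ?thesis by (rule in_G2_ESE[OF G fc ne])
    qed
  qed
qed

end
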